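(* Let $n\ge 1$ and let $w\in\{0,1\}^n$ be the canonical representation of a binary unlabelled necklace. For any positive integer $m\le n$, the number $RankSN(w,m)$ of symmetric necklaces of length $m$ whose canonical representation is smaller than $w$ can be computed in $O(n^6\log^2 n)$ time.
   Context: Alphabet $\{0,1\}$ with $0<1$; words of equal length compared lexicographically, and for different lengths $v<u$ iff $v^{|u|}<u^{|v|}$ lexicographically or these are equal and $|v|<|u|$. A necklace is an equivalence class of words under rotation; its canonical representation is its lexicographically smallest element. $S$ swaps $0$ and $1$ symbolwise; a necklace $N$ is symmetric if $S(N)=N$. A binary unlabelled necklace is an equivalence class of words under rotation and $S$, with canonical representation its lexicographically smallest element. *)

theory Defs
  imports Complex_Main "HOL-Library.List_Lexorder" "HOL-Library.Landau_Symbols"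
begin

section \<open>Words and necklaces\<close>

text \<open>
  Words over \<open>{0,1}\<close> are lists of Booleans with \<open>0 = False < True = 1\<close>. The order \<open><\<close> on lists
  comes from \<^theory>\<open>HOL-Library.List_Lexorder\<close> and is used only between words of equal length.
\<close>

type_synonym word = "bool list"

definition words :: "nat \<Rightarrow> word set" where
  "words n = {v. length v = n}"

definition word_power :: "word \<Rightarrow> nat \<Rightarrow> word" where
  "word_power v k = concat (replicate k v)"

definition word_less :: "word \<Rightarrow> word \<Rightarrow> bool" where
  "word_less v u \<longleftrightarrow>
     (if length v = length u then v < u
      else word_power v (length u) < word_power u (length v) \<or>
           (word_power v (length u) = word_power u (length v) \<and> length v < length u))"

definition swap :: "word \<Rightarrow> word" where
  "swap v = map Not v"

definition rotation_rel :: "(word \<times> word) set" where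
  "rotation_rel = {(u, v). \<exists>k. v = rotate k u}"

definition necklaces :: "nat \<Rightarrow> word set set" where
  "necklaces n = words n // rotation_rel"

definition symmetric_necklace :: "word set \<Rightarrow> bool" where
  "symmetric_necklace N \<longleftrightarrow> swap ` N = N"

definition unlabelled_rel :: "(word \<times> word) set" where
  "unlabelled_rel = {(u, v). \<exists>k. v = rotate k u \<or> v = swap (rotate k u)}"

definition unlabelled_necklaces :: "nat \<Rightarrow> word set set" where
  "unlabelled_necklaces n = words n // unlabelled_rel"

text \<open>Only applied to a class of words of one length, hence to a finite nonempty set.\<close>

definition canonical :: "word set \<Rightarrow> word" where
  "canonical N = Min N"

definition RankSN :: "word \<Rightarrow> nat \<Rightarrow> nat" where
  "RankSN w m = card {N \<in> necklaces m. symmetric_necklace N \<and> word_less (canonical N) w}"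

lemma equiv_rotation_rel: "equiv UNIV rotation_rel"
proof (rule equivI)
  show "refl rotation_rel"
    by (auto simp: refl_on_def rotation_rel_def intro: exI[of _ 0])
  show "sym rotation_rel"
  proof (rule symI)
    fix u v assume "(u, v) \<in> rotation_rel"
    then obtain k where k: "v = rotate k u" by (auto simp: rotation_rel_def)
    have "u = rotate (length u * k - k) v"
    proof (cases "u = []")
      case False
      then have "k \<le> length u * k" by (cases "length u") auto
      then have "rotate (length u * k - k) v = rotate (length u * k) u"
        by (simp add: k rotate_rotate)
      then show ?thesis by (simp add: rotate_id)
    qed (simp add: k)
    then show "(v, u) \<in> rotation_rel" by (auto simp: rotation_rel_def)
  qed
  show "trans rotation_rel"
    by (auto simp: trans_def rotation_rel_def rotate_rotate)
qed auto

lemma equiv_unlabelled_rel: "equiv UNIV unlabelled_rel"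
proof -
  have swap_swap: "swap (swap x) = x" for x by (simp add: swap_def comp_def)
  have iff: "(u, v) \<in> unlabelled_rel \<longleftrightarrow> (u, v) \<in> rotation_rel \<or> (u, swap v) \<in> rotation_rel"
    for u v
  proof -
    have "v = swap (rotate k u) \<longleftrightarrow> swap v = rotate k u" for k
      using swap_swap by metis
    then show ?thesis by (simp add: unlabelled_rel_def rotation_rel_def ex_disj_distrib)
  qed
  have swap_rel: "(swap u, swap v) \<in> rotation_rel" if "(u, v) \<in> rotation_rel" for u v
    using that by (auto simp: rotation_rel_def swap_def rotate_map)
  have R: "(u, u) \<in> rotation_rel" for u
    using equivE[OF equiv_rotation_rel] by (meson UNIV_I refl_onD)
  have S: "(v, u) \<in> rotation_rel" if "(u, v) \<in> rotation_rel" for u v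
    using equivE[OF equiv_rotation_rel] that by (meson symD)
  have T: "(u, x) \<in> rotation_rel" if "(u, v) \<in> rotation_rel" "(v, x) \<in> rotation_rel" for u v x
    using equivE[OF equiv_rotation_rel] that by (meson transD)
  show ?thesis
  proof (rule equivI)
    show "refl unlabelled_rel"
      by (simp add: refl_on_def iff R)
    show "sym unlabelled_rel"
    proof (rule symI)
      fix u v assume "(u, v) \<in> unlabelled_rel"
      then show "(v, u) \<in> unlabelled_rel"
        using S[of u v] S[OF swap_rel[of u "swap v"]] by (auto simp: iff swap_swap)
    qed
    show "trans unlabelled_rel"
    proof (rule transI)
      fix u v x assume "(u, v) \<in> unlabelled_rel" "(v, x) \<in> unlabelled_rel"
      then show "(u, x) \<in> unlabelled_rel"
        using T[of u v x] T[of u v "swap x"] T[of u "swap v" "swap x"] T[of u "swap v" x]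
          swap_rel[of v x] swap_rel[of v "swap x"]
        by (auto simp: iff swap_swap)
    qed
  qed auto
qed


section \<open>Machine model\<close>

text \<open>
  A structured presentation of the random access machine under the uniform cost criterion. A
  program is a fixed term, so it uses finitely many scalar registers and finitely many arrays, all
  holding natural numbers and indexed by natural numbers. One unit is charged for each literal,
  register access, array access, arithmetic operation, comparison, connective, assignment and
  branch. As the only arithmetic operations are addition and truncated subtraction (no
  multiplication, division or shift), each step lengthens the largest stored number by at most one
  bit, so that unit cost does not hide super-polynomial work.
\<close>

datatype aexp =
    Lit nat
  | Var string
  | Read string aexp
  | Plus aexp aexp
  | Minus aexp aexp

datatype bexp =
    Less aexp aexp
  | Equal aexp aexp
  | Neg bexp
  | Conj bexp bexp

datatype com =
    Skip
  | Assign string aexp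
  | Write string aexp aexp
  | Seq com com
  | Ite bexp com com
  | While bexp com

type_synonym state = "(string \<Rightarrow> nat) \<times> (string \<Rightarrow> nat \<Rightarrow> nat)"

fun aval :: "aexp \<Rightarrow> state \<Rightarrow> nat" where
  "aval (Lit k) s = k"
| "aval (Var x) s = fst s x"
| "aval (Read a e) s = snd s a (aval e s)"
| "aval (Plus e f) s = aval e s + aval f s"
| "aval (Minus e f) s = aval e s - aval f s"

fun acost :: "aexp \<Rightarrow> nat" where
  "acost (Lit k) = 1"
| "acost (Var x) = 1"
| "acost (Read a e) = 1 + acost e"
| "acost (Plus e f) = 1 + acost e + acost f"
| "acost (Minus e f) = 1 + acost e + acost f"

fun bval :: "bexp \<Rightarrow> state \<Rightarrow> bool" where
  "bval (Less e f) s \<longleftrightarrow> aval e s < aval f s"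
| "bval (Equal e f) s \<longleftrightarrow> aval e s = aval f s"
| "bval (Neg b) s \<longleftrightarrow> \<not> bval b s"
| "bval (Conj b c) s \<longleftrightarrow> bval b s \<and> bval c s"

fun bcost :: "bexp \<Rightarrow> nat" where
  "bcost (Less e f) = 1 + acost e + acost f"
| "bcost (Equal e f) = 1 + acost e + acost f"
| "bcost (Neg b) = 1 + bcost b"
| "bcost (Conj b c) = 1 + bcost b + bcost c"

text \<open>\<open>exec c s t s'\<close>: started in \<open>s\<close>, program \<open>c\<close> halts in \<open>s'\<close> after \<open>t\<close> steps.\<close>

inductive exec :: "com \<Rightarrow> state \<Rightarrow> nat \<Rightarrow> state \<Rightarrow> bool" where
  Skip: "exec Skip s 1 s"
| Assign: "exec (Assign x e) (r, a) (1 + acost e) (r(x := aval e (r, a)), a)"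
| Write: "exec (Write y e f) (r, a) (1 + acost e + acost f)
            (r, a(y := (a y)(aval e (r, a) := aval f (r, a))))"
| Seq: "exec c s t s' \<Longrightarrow> exec d s' t' s'' \<Longrightarrow> exec (Seq c d) s (t + t') s''"
| IfTrue: "bval b s \<Longrightarrow> exec c s t s' \<Longrightarrow> exec (Ite b c d) s (1 + bcost b + t) s'"
| IfFalse: "\<not> bval b s \<Longrightarrow> exec d s t s' \<Longrightarrow> exec (Ite b c d) s (1 + bcost b + t) s'"
| WhileFalse: "\<not> bval b s \<Longrightarrow> exec (While b c) s (1 + bcost b) s"
| WhileTrue: "bval b s \<Longrightarrow> exec c s t s' \<Longrightarrow> exec (While b c) s' t' s'' \<Longrightarrow>
                exec (While b c) s (1 + bcost b + t + t') s''"

inductive_cases exec_cases: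
  "exec Skip s t s'" "exec (Assign x e) s t s'" "exec (Write y e f) s t s'"
  "exec (Seq c d) s t s'" "exec (Ite b c d) s t s'" "exec (While b c) s t s'"

lemma exec_deterministic:
  "exec c s t s' \<Longrightarrow> exec c s u s'' \<Longrightarrow> u = t \<and> s'' = s'"
proof (induction arbitrary: u s'' rule: exec.induct)
  case (Skip s)
  then show ?case by (auto elim: exec_cases)
next
  case (Assign x e r a)
  then show ?case by (auto elim: exec_cases)
next
  case (Write y e f r a)
  then show ?case by (auto elim: exec_cases)
next
  case (Seq c s t s' d t' s2)
  from Seq.prems obtain v v' r where "exec c s v r" "exec d r v' s''" "u = v + v'"
    by (auto elim: exec_cases)
  with Seq.IH show ?case by blast
next
  case (IfTrue b s c t s' d)
  from IfTrue.prems IfTrue.hyps obtain v where "exec c s v s''" "u = 1 + bcost b + v"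
    by (auto elim: exec_cases)
  with IfTrue.IH show ?case by blast
next
  case (IfFalse b s d t s' c)
  from IfFalse.prems IfFalse.hyps obtain v where "exec d s v s''" "u = 1 + bcost b + v"
    by (auto elim: exec_cases)
  with IfFalse.IH show ?case by blast
next
  case (WhileFalse b s c)
  from WhileFalse.prems WhileFalse.hyps show ?case by (auto elim: exec_cases)
next
  case (WhileTrue b s c t s' t' s2)
  from WhileTrue.prems WhileTrue.hyps obtain v v' r
    where "exec c s v r" "exec (While b c) r v' s''" "u = 1 + bcost b + v + v'"
    by (auto elim: exec_cases)
  with WhileTrue.IH show ?case by blast
qed

text \<open>
  The length of the word and \<open>m\<close> are given in the registers \<open>n\<close> and \<open>m\<close>, the symbols of the word
  in the array \<open>w\<close>; everything else is initially \<open>0\<close>. The result is left in the register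
  \<open>result\<close>.
\<close>

definition initial :: "word \<Rightarrow> nat \<Rightarrow> state" where
  "initial w m =
     ((\<lambda>x. 0)(''n'' := length w, ''m'' := m),
      (\<lambda>y i. 0)(''w'' := (\<lambda>i. if i < length w then of_bool (w ! i) else 0)))"

definition final_result :: "state \<Rightarrow> nat" where
  "final_result s = fst s ''result''"

end

(*
  A word is symmetric iff its periodic extension y has an antiperiod d, that is y (i + d) = \<not> y i;
  equivalently it is a rotation of a power of v @ swap v with |v| = d. The antiperiods of y are the
  odd multiples of the least one, e, and the necklace has 2 * e elements. Hence the rank is the sum
  over all e with 2 * e dividing m of the number of y with least antiperiod e and with some shift
  not above the periodic extension W of w, divided by 2 * e; when m = length w and w is symmetric,
  its own necklace has to be discounted.

  Every shift of y lies strictly above W iff the automaton reading y in a cycle, which records how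
  much of W has just been read, has a cyclic run, and then this run is unique. So the words v of
  length d with all shifts of v @ swap v above W are counted by summing, over pairs of states (q, r),
  the number of v leading from q to r while swap v leads from r to q. For all d at once this is a
  dynamic program over pairs of states, with five nested loops, so O(n^5) steps. A sieve over odd
  multiples isolates the least antiperiod.
*)
theory Submission
  imports Defs
begin

text \<open>The complement is counted because "all shifts above \<open>W\<close>" is a safety
  condition: the automaton only has to avoid its sink. The obstacle is that the word is cyclic and
  its second half is the negation of the first. Its run has no given start, and the second half
  starts in a state that depends on the first. Guessing both the initial state \<open>q\<close> and
  the middle state \<open>r\<close> lets two copies of the automaton advance in lockstep on the same
  \<open>v\<close>, one reading it negated. Uniqueness of the cyclic run turns the sum over the
  guesses into a count of words.

  Only \<open>n\<close> live states are needed: a sequence of period at most \<open>n\<close> with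
  all shifts above \<open>W\<close> leaves \<open>W\<close> within \<open>n\<close> symbols, so a
  full match may be rejected. Minimality of \<open>W\<close> among its rotations supplies both this
  and the missing failure function.

  The machine only adds and subtracts. Hence row offsets are tabulated, powers of two come from
  doubling, divisibility is tested by stepping through multiples, and division is binary long
  division; repeated subtraction could take exponential time. The five loops of the dynamic program
  (\<open>q\<close>, \<open>r\<close>, the length and two current states) dominate everything
  else.\<close>

section \<open>Lexicographic order on sequences\<close>

text \<open>On periodic extensions the order between words of different lengths becomes this one
  order, apart from the tie-break by length.\<close>

definition seq_less :: "(nat \<Rightarrow> bool) \<Rightarrow> (nat \<Rightarrow> bool) \<Rightarrow> bool" where
  "seq_less x y \<longleftrightarrow> (\<exists>l. (\<forall>i<l. x i = y i) \<and> \<not> x l \<and> y l)"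

lemma seq_less_linear: "seq_less x y \<or> x = y \<or> seq_less y x"
proof (cases "x = y")
  case False
  then have ex: "\<exists>l. x l \<noteq> y l" by auto
  define l where "l = (LEAST l. x l \<noteq> y l)"
  have "x l \<noteq> y l" unfolding l_def using ex by (rule LeastI_ex)
  moreover have "\<forall>i<l. x i = y i" unfolding l_def using not_less_Least by blast
  ultimately show ?thesis unfolding seq_less_def by metis
qed simp

lemma seq_less_asym: "seq_less x y \<Longrightarrow> \<not> seq_less y x"
  unfolding seq_less_def by (metis nat_neq_iff)

lemma seq_less_irrefl: "\<not> seq_less x x"
  unfolding seq_less_def by blast

lemma seq_less_trans: "seq_less x y \<Longrightarrow> seq_less y z \<Longrightarrow> seq_less x z"
proof -
  assume "seq_less x y" "seq_less y z"
  then obtain l k where "\<forall>i<l. x i = y i" "\<not> x l" "y l" "\<forall>i<k. y i = z i" "\<not> y k" "z k"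
    unfolding seq_less_def by blast
  note * = this
  consider "l < k" | "l = k" | "k < l" by linarith
  then show ?thesis
  proof cases
    case 1
    then show ?thesis unfolding seq_less_def using * by (intro exI[of _ l]) auto
  next
    case 2
    then show ?thesis using * by simp
  next
    case 3
    then show ?thesis unfolding seq_less_def using * by (intro exI[of _ k]) auto
  qed
qed

lemma not_seq_less_agree:
  assumes "\<not> seq_less y x" "\<forall>i<l. x i = y i" "\<not> y l"
  shows "\<not> x l"
  using assms unfolding seq_less_def by metis

definition above :: "(nat \<Rightarrow> bool) \<Rightarrow> (nat \<Rightarrow> bool) \<Rightarrow> bool" where
  "above W y \<longleftrightarrow> (\<forall>k. seq_less W (\<lambda>i. y (i + k)))"


section \<open>An automaton recognising the cyclic words above a necklace\<close>

text \<open>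
  In state \<open>q < n\<close> the last \<open>q\<close> symbols form the longest suffix of the text that is a prefix of
  \<open>W\<close>; state \<open>n\<close> is the rejecting sink. No failure function is needed: when \<open>1\<close> is read where
  \<open>W\<close> has \<open>0\<close>, minimality of \<open>W\<close> among its shifts excludes every shorter match.
\<close>

definition step :: "(nat \<Rightarrow> bool) \<Rightarrow> nat \<Rightarrow> nat \<Rightarrow> bool \<Rightarrow> nat" where
  "step W n q c = (if n \<le> q then n else if c = W q then Suc q else if c then 0 else n)"

fun run :: "(nat \<Rightarrow> bool) \<Rightarrow> nat \<Rightarrow> nat \<Rightarrow> word \<Rightarrow> nat" where
  "run W n q [] = q"
| "run W n q (c # v) = run W n (step W n q c) v"

lemma run_append: "run W n q (u @ v) = run W n (run W n q u) v"
  by (induction u arbitrary: q) auto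

lemma step_le: "step W n q c \<le> n"
  by (simp add: step_def)

lemma run_le: "q \<le> n \<Longrightarrow> run W n q v \<le> n"
  by (induction v arbitrary: q) (auto simp: step_le)

lemma run_sink: "run W n n v = n"
  by (induction v) (auto simp: step_def)

definition cyclic_run ::
  "(nat \<Rightarrow> bool) \<Rightarrow> nat \<Rightarrow> (nat \<Rightarrow> bool) \<Rightarrow> nat \<Rightarrow> (nat \<Rightarrow> nat) \<Rightarrow> bool" where
  "cyclic_run W n y p \<sigma> \<longleftrightarrow>
     (\<forall>i. \<sigma> i < n \<and> \<sigma> (Suc i) = step W n (\<sigma> i) (y i) \<and> \<sigma> (i + p) = \<sigma> i)"

lemma periodic_mult:
  fixes y :: "nat \<Rightarrow> 'a"
  assumes "\<And>i. y (i + p) = y i"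
  shows "y (i + p * k) = y i"
proof (induction k)
  case (Suc k)
  have "y (i + p * Suc k) = y ((i + p * k) + p)" by (simp add: algebra_simps)
  then show ?case using assms Suc by simp
qed simp

text \<open>A run that matched forever would raise its state past \<open>n\<close>, so a mismatch
  occurs. As the sink is excluded, the mismatch reads \<open>1\<close> against \<open>0\<close> and
  leads to state \<open>0\<close>.\<close>

lemma cyclic_run_reset:
  assumes "cyclic_run W n y p \<sigma>"
  obtains r where "\<forall>j<r. y (k + j) = W (\<sigma> k + j)" "\<forall>j\<le>r. \<sigma> (k + j) = \<sigma> k + j"
    "\<not> W (\<sigma> k + r)" "y (k + r)" "\<sigma> (Suc (k + r)) = 0"
proof -
  have lt: "\<sigma> i < n" and st: "\<sigma> (Suc i) = step W n (\<sigma> i) (y i)" for i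
    using assms unfolding cyclic_run_def by auto
  have follow: "\<sigma> (k + j) = \<sigma> k + j" if "\<forall>i<j. y (k + i) = W (\<sigma> k + i)" for j
    using that
  proof (induction j)
    case (Suc j)
    then have "\<sigma> (k + j) = \<sigma> k + j" "y (k + j) = W (\<sigma> k + j)" by auto
    then show ?case using st[of "k + j"] lt[of "k + j"] by (simp add: step_def)
  qed simp
  have ex: "\<exists>r. y (k + r) \<noteq> W (\<sigma> k + r)"
  proof (rule ccontr)
    assume "\<not> ?thesis"
    then have "\<sigma> (k + n) = \<sigma> k + n" using follow by blast
    then show False using lt[of "k + n"] by simp
  qed
  define r where "r = (LEAST r. y (k + r) \<noteq> W (\<sigma> k + r))"
  have ne: "y (k + r) \<noteq> W (\<sigma> k + r)" unfolding r_def using ex by (rule LeastI_ex)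
  have eq: "\<forall>j<r. y (k + j) = W (\<sigma> k + j)" unfolding r_def using not_less_Least by blast
  have fr: "\<forall>j\<le>r. \<sigma> (k + j) = \<sigma> k + j" using follow eq by auto
  have "\<sigma> (Suc (k + r)) = (if y (k + r) then 0 else n)"
    using st[of "k + r"] fr lt[of "k + r"] ne by (simp add: step_def)
  then have "y (k + r)" "\<sigma> (Suc (k + r)) = 0"
    using lt[of "Suc (k + r)"] by (auto split: if_splits)
  then show thesis using that eq fr ne by blast
qed

text \<open>In a cyclic run a nonzero state is entered only by a match, so state \<open>t\<close>
  can be traced back through \<open>t\<close> matches to state \<open>0\<close>.\<close>

lemma cyclic_run_back:
  assumes "cyclic_run W n y p \<sigma>" "\<sigma> k = t" "t \<le> k"
  shows "\<sigma> (k - t) = 0 \<and> (\<forall>j<t. y (k - t + j) = W j)"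
  using assms(2,3)
proof (induction t arbitrary: k)
  case (Suc t)
  then obtain k' where k: "k = Suc k'" by (cases k) auto
  have "\<sigma> k < n" "\<sigma> k = step W n (\<sigma> k') (y k')"
    using assms(1) unfolding cyclic_run_def k by blast+
  then have *: "\<sigma> k' = t" "y k' = W t"
    using Suc.prems by (auto simp: step_def split: if_splits)
  have t: "t \<le> k'" using Suc.prems k by simp
  from Suc.IH[OF *(1) t] show ?case
    using * k t by (auto simp: less_Suc_eq)
qed simp

locale necklace_seq =
  fixes W :: "nat \<Rightarrow> bool" and n :: nat
  assumes shift_min: "\<not> seq_less (\<lambda>i. W (i + k)) W"
begin

text \<open>If \<open>W r\<close> were \<open>1\<close>, the shift of \<open>W\<close> by
  \<open>s\<close> would lie below \<open>W\<close>. Minimality enters the automaton proofs in this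
  form only.\<close>

lemma shift_agree:
  assumes "\<forall>j<r. W (s + j) = W j" "\<not> W (s + r)"
  shows "\<not> W r"
  using not_seq_less_agree[of "\<lambda>i. W (i + s)" W r] shift_min[of s] assms
  by (simp add: add.commute)

text \<open>A first difference \<open>l\<close> at or beyond the period \<open>p\<close> would carry
  the value \<open>1\<close> of \<open>y\<close> back to \<open>W\<close> at \<open>l - p\<close>,
  whereas minimality of \<open>W\<close> forces \<open>0\<close> there. So no shift of a sequence
  that is above \<open>W\<close> matches \<open>n\<close> symbols, and the automaton may send a full
  match to the sink.\<close>

lemma seq_less_before:
  assumes "0 < p" "p \<le> n" "\<And>i. y (i + p) = y i" "seq_less W y"
  obtains l where "l < n" "\<forall>i<l. W i = y i" "\<not> W l" "y l"
proof -
  from assms(4) obtain l where l: "\<forall>i<l. W i = y i" "\<not> W l" "y l"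
    unfolding seq_less_def by blast
  have "l < n"
  proof (rule ccontr)
    assume "\<not> l < n"
    then have "p \<le> l" using assms by simp
    have "W (p + j) = W j" if "j < l - p" for j
    proof -
      have "W (p + j) = y (j + p)" using l that by (simp add: add.commute)
      then show ?thesis using assms(3)[of j] l that by simp
    qed
    then have "\<not> W (l - p)" using shift_agree[of "l - p" p] l \<open>p \<le> l\<close> by simp
    moreover have "W (l - p) = y (l - p)" using l(1) assms(1) \<open>p \<le> l\<close> by simp
    moreover have "y (l - p + p) = y (l - p)" by (rule assms(3))
    ultimately show False using l \<open>p \<le> l\<close> by simp
  qed
  with l that show thesis by blast
qed

text \<open>From time \<open>k\<close> on, \<open>y\<close> copies the shift of \<open>W\<close> by
  \<open>\<sigma> k\<close> up to the reset, where it exceeds that shift. The shift itself is not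
  below \<open>W\<close>, so \<open>y\<close> read from \<open>k\<close> exceeds \<open>W\<close>
  either at the reset or where the shift first leaves \<open>W\<close>.\<close>

lemma above_if_cyclic_run:
  assumes "cyclic_run W n y p \<sigma>"
  shows "above W y"
  unfolding above_def
proof
  fix k
  obtain r where r: "\<forall>j<r. y (k + j) = W (\<sigma> k + j)" "\<not> W (\<sigma> k + r)" "y (k + r)"
    using cyclic_run_reset[OF assms] by metis
  show "seq_less W (\<lambda>i. y (i + k))"
  proof (cases "\<forall>j<r. W (\<sigma> k + j) = W j")
    case True
    then have "\<not> W r" using shift_agree r by blast
    then show ?thesis unfolding seq_less_def
      using True r by (intro exI[of _ r]) (simp add: add.commute)
  next
    case False
    then have ex: "\<exists>l. W (\<sigma> k + l) \<noteq> W l" by blast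
    define l where "l = (LEAST l. W (\<sigma> k + l) \<noteq> W l)"
    have ne: "W (\<sigma> k + l) \<noteq> W l" unfolding l_def using ex by (rule LeastI_ex)
    have eq: "\<forall>j<l. W (\<sigma> k + j) = W j" unfolding l_def using not_less_Least by blast
    have "l < r"
    proof (rule ccontr)
      assume "\<not> l < r"
      then show False using False eq by auto
    qed
    moreover have "\<not> W l" using shift_agree[OF eq] ne by blast
    moreover have "y (l + k)"
      using r(1) \<open>l < r\<close> \<open>\<not> W l\<close> ne by (simp add: add.commute[of l])
    moreover have "\<forall>i<l. W i = y (i + k)"
      using r(1) \<open>l < r\<close> eq by (simp add: add.commute[of _ k])
    ultimately show ?thesis unfolding seq_less_def by blast
  qed
qed

lemma cyclic_run_unique:
  assumes p: "0 < p" and \<sigma>: "cyclic_run W n y p \<sigma>" and \<tau>: "cyclic_run W n y p \<tau>"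
  shows "\<sigma> = \<tau>"
proof -
  \<comment> \<open>Determinism carries the equality forward, and periodicity carries it back to
    earlier times.\<close>
  have coincide: "\<sigma> = \<tau>" if "\<sigma> k = \<tau> k" for k
  proof
    fix i
    have eq: "\<sigma> (k + j) = \<tau> (k + j)" for j
      by (induction j) (use that \<sigma> \<tau> in \<open>auto simp: cyclic_run_def\<close>)
    have "k \<le> i + p * k" using p by (cases p) auto
    then have "\<sigma> (i + p * k) = \<tau> (i + p * k)" using eq[of "i + p * k - k"] by simp
    then show "\<sigma> i = \<tau> i"
      using periodic_mult[of \<sigma> p i k] periodic_mult[of \<tau> p i k] \<sigma> \<tau>
      by (simp add: cyclic_run_def)
  qed
  \<comment> \<open>A reset at time \<open>n\<close> or later leaves room to trace any state below
    \<open>n\<close> back to \<open>0\<close>.\<close>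
  obtain r where "\<sigma> (Suc (n + r)) = 0" using cyclic_run_reset[OF \<sigma>, of n] by metis
  then obtain k where k: "\<sigma> k = 0" "n \<le> k" by (metis le_add1 le_SucI)
  define t where "t = \<tau> k"
  define k' where "k' = k - t"
  have "t < n" using \<tau> unfolding t_def cyclic_run_def by simp
  then have "t \<le> k" using k by simp
  then have t: "\<tau> k' = 0" "\<forall>j<t. y (k' + j) = W j" and kk: "k = k' + t"
    using cyclic_run_back[OF \<tau>, of k t] unfolding t_def k'_def by auto
  obtain r where r: "\<forall>j<r. y (k' + j) = W (\<sigma> k' + j)" "\<forall>j\<le>r. \<sigma> (k' + j) = \<sigma> k' + j"
    "\<not> W (\<sigma> k' + r)" "y (k' + r)" using cyclic_run_reset[OF \<sigma>, of k'] by metis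
  show ?thesis
  proof (cases "\<sigma> k' = 0")
    case True
    then show ?thesis using coincide[of k'] t by simp
  next
    case False
    \<comment> \<open>Since \<open>\<sigma>\<close> is \<open>0\<close> at time \<open>k\<close>,
      its run after \<open>k'\<close> must reset while \<open>\<tau>\<close> is still matching
      \<open>W\<close>; the symbol \<open>1\<close> read there contradicts minimality.\<close>
    have "r < t"
    proof (rule ccontr)
      assume "\<not> r < t"
      then have "\<sigma> (k' + t) = \<sigma> k' + t" using r by simp
      then show False using k kk False by simp
    qed
    have "\<forall>j<r. W (\<sigma> k' + j) = W j" using r(1) t(2) \<open>r < t\<close> by (metis less_trans)
    then have "\<not> W r" using shift_agree r(3) by blast
    then show ?thesis using t(2) \<open>r < t\<close> r(4) by blast
  qed
qed

lemma cyclic_run_if_above: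
  assumes p: "0 < p" "p \<le> n" and per: "\<And>i. y (i + p) = y i" and ab: "above W y"
  shows "\<exists>\<sigma>. cyclic_run W n y p \<sigma>"
proof -
  have n: "0 < n" and np: "n \<le> n * p" using p by auto
  \<comment> \<open>The last \<open>t\<close> symbols before \<open>k\<close> form a prefix of
    \<open>W\<close>. Adding \<open>n * p\<close>, a multiple of the period that is at least
    \<open>n\<close>, keeps the index from being truncated.\<close>
  define match where "match k t \<longleftrightarrow> t < n \<and> (\<forall>j<t. y (k + n * p - t + j) = W j)" for k t
  define \<sigma> where "\<sigma> k = Max {t. match k t}" for k
  have fin: "finite {t. match k t}" for k
    by (rule finite_subset[of _ "{..<n}"]) (auto simp: match_def)
  have m0: "match k 0" for k using n by (simp add: match_def)
  have \<sigma>: "match k (\<sigma> k)" for k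
    using Max_in[OF fin, of k] m0[of k] unfolding \<sigma>_def by auto
  have \<sigma>_ge: "t \<le> \<sigma> k" if "match k t" for k t
    using that unfolding \<sigma>_def by (intro Max_ge fin) simp
  have idx: "y (k + n * p - t + t) = y k" if "t < n" for k t
  proof -
    have "k + n * p - t + t = k + p * n" using that np mult.commute[of n p] by linarith
    then show ?thesis using periodic_mult[of y p k n] per by simp
  qed
  \<comment> \<open>Reading \<open>0\<close> where \<open>W\<close> has \<open>1\<close> after a
    match would put a shift of \<open>y\<close> below \<open>W\<close>.\<close>
  have bit: "match k t \<Longrightarrow> y k \<or> \<not> W t" for k t
  proof (rule ccontr)
    assume "match k t" "\<not> (y k \<or> \<not> W t)"
    then have "seq_less (\<lambda>i. y (i + (k + n * p - t))) W"
      unfolding seq_less_def match_def using idx[of t k]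
      by (intro exI[of _ t]) (auto simp: add.commute)
    then show False using ab seq_less_asym unfolding above_def by blast
  qed
  have next1: "match (Suc k) (Suc t)" if "match k t" "y k = W t" for k t
  proof -
    have t: "t < n" using that by (simp add: match_def)
    have e: "Suc k + n * p - Suc t = k + n * p - t" by simp
    have ext: "\<forall>j<Suc t. y (k + n * p - t + j) = W j"
      using that idx[OF t, of k] by (auto simp: match_def less_Suc_eq)
    \<comment> \<open>A match of all \<open>n\<close> symbols contradicts
      \<open>seq_less_before\<close>.\<close>
    have "Suc t < n"
    proof (rule ccontr)
      assume "\<not> Suc t < n"
      then have *: "\<forall>j<n. y (j + (k + n * p - t)) = W j" using ext by (simp add: add.commute)
      have per': "y (i + p + (k + n * p - t)) = y (i + (k + n * p - t))" for i
        using per[of "i + (k + n * p - t)"] by (simp only: ac_simps)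
      have "seq_less W (\<lambda>i. y (i + (k + n * p - t)))"
        using ab unfolding above_def by blast
      from seq_less_before[OF p per' this]
      obtain l where "l < n" "\<not> W l" "y (l + (k + n * p - t))" by metis
      then show False using * by simp
    qed
    then show ?thesis using ext unfolding match_def e by simp
  qed
  have prev: "match k t \<and> y k = W t" if "match (Suc k) (Suc t)" for k t
  proof -
    have e: "Suc k + n * p - Suc t = k + n * p - t" by simp
    show ?thesis using that idx[of t k] unfolding match_def e by auto
  qed
  have "\<sigma> (Suc k) = step W n (\<sigma> k) (y k)" for k
  proof (cases "y k = W (\<sigma> k)")
    case True
    have "\<sigma> (Suc k) = Suc (\<sigma> k)"
    proof (rule antisym)
      show "Suc (\<sigma> k) \<le> \<sigma> (Suc k)" by (rule \<sigma>_ge) (rule next1[OF \<sigma> True])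
      show "\<sigma> (Suc k) \<le> Suc (\<sigma> k)"
        using \<sigma>[of "Suc k"] prev[of k] \<sigma>_ge[of k] by (cases "\<sigma> (Suc k)") auto
    qed
    then show ?thesis using True \<sigma>[of k] by (simp add: step_def match_def)
  next
    case False
    then have b: "y k" "\<not> W (\<sigma> k)" using bit[OF \<sigma>, of k] by auto
    \<comment> \<open>A shorter match \<open>t\<close> that continues with \<open>1\<close> is a
      border of the longest match, which \<open>W\<close> continues with \<open>0\<close>.
      Minimality then makes \<open>W t\<close> equal to \<open>0\<close> as well.\<close>
    have "\<sigma> (Suc k) = 0"
    proof (rule ccontr)
      assume "\<sigma> (Suc k) \<noteq> 0"
      then obtain t where "\<sigma> (Suc k) = Suc t" using not0_implies_Suc by blast
      then have t: "match k t" "W t" using prev[of k t] \<sigma>[of "Suc k"] b by auto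
      define s where "s = \<sigma> k - t"
      have "t \<le> \<sigma> k" using \<sigma>_ge t by blast
      then have st: "\<sigma> k = s + t" by (simp add: s_def)
      have ln: "\<sigma> k < n" using \<sigma>[of k] by (simp add: match_def)
      have "W (s + j) = W j" if "j < t" for j
      proof -
        have "y (k + n * p - \<sigma> k + (s + j)) = W (s + j)"
          using \<sigma>[of k] that st by (simp add: match_def)
        moreover have "y (k + n * p - t + j) = W j" using t that by (simp add: match_def)
        moreover have "k + n * p - \<sigma> k + (s + j) = k + n * p - t + j"
          using st ln np by linarith
        ultimately show ?thesis by simp
      qed
      then have "\<not> W t" using shift_agree[of t s] b st by simp
      then show False using t by simp
    qed
    then show ?thesis using b \<sigma>[of k] by (simp add: step_def match_def)
  qed
  moreover have "\<sigma> (k + p) = \<sigma> k" for k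
  proof -
    have "match (k + p) t = match k t" for t
    proof -
      have "k + p + n * p - t + j = k + n * p - t + j + p" if "t < n" for j
        using np that by linarith
      then show ?thesis unfolding match_def using per by metis
    qed
    then show ?thesis by (simp add: \<sigma>_def)
  qed
  ultimately have "cyclic_run W n y p \<sigma>"
    using \<sigma> unfolding cyclic_run_def match_def by blast
  then show ?thesis by blast
qed

end


section \<open>Words as periodic sequences\<close>

definition cyc :: "word \<Rightarrow> nat \<Rightarrow> bool" where
  "cyc x i = x ! (i mod length x)"

lemma cyc_period: "cyc x (i + length x) = cyc x i"
  by (simp add: cyc_def)

lemma cyc_rotate: "x \<noteq> [] \<Longrightarrow> cyc (rotate k x) i = cyc x (i + k)"
  by (simp add: cyc_def nth_rotate mod_simps add.commute)

lemma cyc_swap: "x \<noteq> [] \<Longrightarrow> cyc (swap x) i = (\<not> cyc x i)"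
  by (simp add: cyc_def swap_def)

lemma cyc_nth: "i < length x \<Longrightarrow> cyc x i = x ! i"
  by (simp add: cyc_def)

lemma cyc_eq_iff:
  assumes "length x = length y"
  shows "cyc x = cyc y \<longleftrightarrow> x = y"
proof
  assume "cyc x = cyc y"
  then have "x ! i = y ! i" if "i < length x" for i
    using that assms cyc_nth[of i x] cyc_nth[of i y] by simp
  then show "x = y" using assms by (intro nth_equalityI)
qed simp

lemma periodic_mod:
  fixes y :: "nat \<Rightarrow> 'a"
  assumes "\<And>i. y (i + m) = y i"
  shows "y (i mod m) = y i"
  using periodic_mult[of y m "i mod m" "i div m", OF assms] by simp

lemma cyc_map_upt:
  assumes "0 < m" "\<And>i. y (i + m) = y i"
  shows "cyc (map y [0..<m]) = y"
  using assms periodic_mod[of y m] by (auto simp: cyc_def)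

lemma length_word_power: "length (word_power v k) = k * length v"
  by (induction k) (simp_all add: word_power_def)

lemma nth_word_power: "i < k * length v \<Longrightarrow> word_power v k ! i = cyc v i"
proof (induction k arbitrary: i)
  case (Suc k)
  have *: "word_power v (Suc k) = v @ word_power v k" by (simp add: word_power_def)
  show ?case
  proof (cases "i < length v")
    case True
    then show ?thesis by (simp add: * nth_append cyc_nth)
  next
    case False
    then show ?thesis
      using Suc.IH[of "i - length v"] Suc.prems cyc_period[of v "i - length v"]
      by (simp add: * nth_append)
  qed
qed simp

lemma seq_eq_if_period:
  assumes "\<And>i. U (i + L) = U i" "\<And>i. V (i + L) = V i" "\<And>i. i < L \<Longrightarrow> U i = V i" "0 < (L::nat)"
  shows "U = V"
proof
  fix i
  show "U i = V i"
    using periodic_mod[of U L i] periodic_mod[of V L i] assms by (metis mod_less_divisor)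
qed

text \<open>Two sequences of period \<open>L\<close> that differ at all first differ within
  \<open>L\<close> places, the part that the words show.\<close>

lemma word_less_iff_seq_less:
  assumes "length u = L" "length v = L" "0 < L"
    and U: "\<And>i. i < L \<Longrightarrow> u ! i = U i" "\<And>i. U (i + L) = U i"
    and V: "\<And>i. i < L \<Longrightarrow> v ! i = V i" "\<And>i. V (i + L) = V i"
  shows "u < v \<longleftrightarrow> seq_less U V" "u = v \<longleftrightarrow> U = V"
proof -
  have take: "take i u = take i v \<longleftrightarrow> (\<forall>j<i. U j = V j)" if "i < L" for i
    using that assms(1,2) U(1) V(1) by (auto simp: list_eq_iff_nth_eq)
  have "u < v \<longleftrightarrow> (\<exists>i<L. take i u = take i v \<and> u ! i < v ! i)"
    using assms(1,2) by (simp add: list_less_def lexord_take_index_conv)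
  also have "\<dots> \<longleftrightarrow> (\<exists>i<L. (\<forall>j<i. U j = V j) \<and> \<not> U i \<and> V i)"
    by (intro ex_cong1 conj_cong refl) (simp_all add: take U(1) V(1))
  also have "\<dots> \<longleftrightarrow> seq_less U V"
  proof
    assume "seq_less U V"
    then obtain l where l: "\<forall>j<l. U j = V j" "\<not> U l" "V l" unfolding seq_less_def by blast
    have "l < L"
    proof (rule ccontr)
      assume "\<not> l < L"
      then have "l - L < l" "l - L + L = l" using \<open>0 < L\<close> by auto
      then show False using l U(2)[of "l - L"] V(2)[of "l - L"] by metis
    qed
    with l show "\<exists>i<L. (\<forall>j<i. U j = V j) \<and> \<not> U i \<and> V i" by blast
  qed (auto simp: seq_less_def)
  finally show "u < v \<longleftrightarrow> seq_less U V" .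
  show "u = v \<longleftrightarrow> U = V"
  proof
    assume "u = v"
    then show "U = V" using seq_eq_if_period[of U L V] assms by metis
  next
    assume "U = V"
    then show "u = v" using assms by (intro nth_equalityI) auto
  qed
qed

lemma less_iff_cyc:
  assumes "length u = length v"
  shows "u < v \<longleftrightarrow> seq_less (cyc u) (cyc v)"
proof (cases "u = []")
  case True
  then show ?thesis using assms seq_less_irrefl by simp
next
  case False
  have "cyc v (i + length u) = cyc v i" for i using cyc_period[of v i] assms by simp
  then show ?thesis
    by (intro word_less_iff_seq_less(1)[where L = "length u"])
       (simp_all add: assms[symmetric] False cyc_nth cyc_period)
qed

lemma cyc_period_mult: "cyc v (i + k * length v) = cyc v i"
  using periodic_mult[of "cyc v" "length v" i k] cyc_period[of v] by (simp add: mult.commute)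

text \<open>The two powers have the common length \<open>length w * length x\<close> and are
  prefixes of the periodic extensions, both of which have that length as a period.\<close>

lemma word_less_iff_cyc:
  assumes "x \<noteq> []" "w \<noteq> []"
  shows "word_less x w \<longleftrightarrow>
    seq_less (cyc x) (cyc w) \<or> (cyc x = cyc w \<and> length x < length w)"
proof (cases "length x = length w")
  case True
  then show ?thesis using less_iff_cyc by (simp add: word_less_def)
next
  case False
  define L where "L = length w * length x"
  have "0 < L" using assms by (simp add: L_def)
  have "word_power x (length w) < word_power w (length x) \<longleftrightarrow> seq_less (cyc x) (cyc w)"
    "word_power x (length w) = word_power w (length x) \<longleftrightarrow> cyc x = cyc w"
  proof -
    have "cyc x (i + L) = cyc x i" "cyc w (i + L) = cyc w i" for i
      using cyc_period_mult[of x i "length w"] cyc_period_mult[of w i "length x"]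
      by (simp_all add: L_def mult.commute)
    moreover have "word_power x (length w) ! i = cyc x i" "word_power w (length x) ! i = cyc w i"
      if "i < L" for i
      using that by (simp_all add: L_def nth_word_power mult.commute)
    moreover have "length (word_power x (length w)) = L" "length (word_power w (length x)) = L"
      by (simp_all add: L_def length_word_power)
    ultimately show "word_power x (length w) < word_power w (length x) \<longleftrightarrow> seq_less (cyc x) (cyc w)"
      "word_power x (length w) = word_power w (length x) \<longleftrightarrow> cyc x = cyc w"
      using \<open>0 < L\<close> by (intro word_less_iff_seq_less[of _ L]; simp)+
  qed
  then show ?thesis using False by (simp add: word_less_def)
qed


section \<open>Antiperiods\<close>

definition anti :: "nat \<Rightarrow> (nat \<Rightarrow> bool) \<Rightarrow> bool" where
  "anti d y \<longleftrightarrow> (\<forall>i. y (i + d) \<longleftrightarrow> \<not> y i)"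

definition least_anti :: "(nat \<Rightarrow> bool) \<Rightarrow> nat" where
  "least_anti y = (LEAST d. anti d y)"

lemma anti_least_anti: "anti d y \<Longrightarrow> anti (least_anti y) y"
  unfolding least_anti_def by (rule LeastI)

lemma least_anti_le: "anti d y \<Longrightarrow> least_anti y \<le> d"
  unfolding least_anti_def by (rule Least_le)

lemma anti_pos: "anti d y \<Longrightarrow> 0 < d"
  unfolding anti_def by (cases d) auto

lemma anti_period: "anti d y \<Longrightarrow> y (i + 2 * d) = y i"
  unfolding anti_def by (metis add.assoc mult_2)

lemma anti_mod_period:
  assumes "\<And>i. y (i + p) = y i"
  shows "anti (d mod p) y \<longleftrightarrow> anti d y"
proof -
  have "y (i + d mod p) = y (i + d)" for i
    using periodic_mult[of y p "i + d mod p" "d div p", OF assms] by (simp add: add.assoc)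
  then show ?thesis by (simp add: anti_def)
qed

lemma anti_diff:
  assumes "anti d y" "\<And>i. y (i + r) = y i" "r \<le> d"
  shows "anti (d - r) y"
  unfolding anti_def
proof
  fix i
  have "y (i + (d - r)) = y (i + (d - r) + r)" using assms(2) by simp
  also have "i + (d - r) + r = i + d" using assms(3) by simp
  finally show "y (i + (d - r)) \<longleftrightarrow> \<not> y i" using assms(1) by (simp add: anti_def)
qed

text \<open>The difference of an antiperiod and a period, in either order, is again an antiperiod. A
  smaller period would thus produce an antiperiod below the least one.\<close>

lemma period_ge_least_anti:
  assumes "anti e y" "0 < r" "\<And>i. y (i + r) = y i"
  shows "2 * least_anti y \<le> r"
proof (rule ccontr)
  define e' where "e' = least_anti y"
  have e': "anti e' y" "\<And>d. anti d y \<Longrightarrow> e' \<le> d"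
    using assms(1) anti_least_anti least_anti_le by (auto simp: e'_def)
  assume "\<not> 2 * least_anti y \<le> r"
  then have lt: "r < 2 * e'" by (simp add: e'_def)
  have "\<not> (r \<le> e')"
    using anti_diff[OF e'(1) assms(3)] e' anti_pos[OF e'(1)] \<open>0 < r\<close>
    by (metis diff_less not_less)
  then have "e' \<le> r" by simp
  have "anti (r - e') y" unfolding anti_def
  proof
    fix i
    have "y i = y (i + (r - e') + e')" using assms(3)[of i] \<open>e' \<le> r\<close> by simp
    also have "\<dots> = (\<not> y (i + (r - e')))" using e'(1) by (simp only: anti_def)
    finally show "y (i + (r - e')) \<longleftrightarrow> \<not> y i" by simp
  qed
  then show False using e'(2) lt by fastforce
qed

text \<open>The remainder of \<open>m\<close> modulo the least period
  \<open>2 * least_anti y\<close> is a period again, hence \<open>0\<close>.\<close>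

lemma double_least_anti_dvd_period:
  assumes "anti e y" "\<And>i. y (i + m) = y i"
  shows "2 * least_anti y dvd m"
proof (rule ccontr)
  define p where "p = 2 * least_anti y"
  have p: "y (i + p) = y i" for i
    using anti_period anti_least_anti assms(1) unfolding p_def by blast
  have "0 < p" using anti_pos[OF anti_least_anti[OF assms(1)]] by (simp add: p_def)
  assume "\<not> 2 * least_anti y dvd m"
  then have "0 < m mod p" by (simp add: p_def dvd_eq_mod_eq_0)
  moreover have "y (i + m mod p) = y i" for i
    using periodic_mult[of y p "i + m mod p" "m div p", OF p] assms(2)[of i]
    by (simp add: add.assoc)
  ultimately have "p \<le> m mod p" using period_ge_least_anti[OF assms(1)] unfolding p_def by blast
  then show False using \<open>0 < p\<close> by (metis mod_less_divisor not_less)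
qed

lemma anti_odd_mult:
  assumes "anti e y"
  shows "anti ((2 * q + 1) * e) y"
proof -
  have "(2 * q + 1) * e mod (2 * e) = e mod (2 * e)"
    using mod_mult_self2[of e "2 * e" q] by (simp add: algebra_simps)
  then show ?thesis using anti_mod_period[of y "2 * e"] anti_period[OF assms] assms by metis
qed

text \<open>The sum of two antiperiods is a period, so \<open>d + e\<close> is a multiple of
  \<open>2 * e\<close> for the least antiperiod \<open>e\<close>.\<close>

lemma anti_is_odd_mult:
  assumes "anti d y"
  shows "\<exists>q. d = (2 * q + 1) * least_anti y"
proof -
  define e where "e = least_anti y"
  have e: "anti e y" using anti_least_anti assms by (simp add: e_def)
  have "y (i + (d + e)) = y i" for i
    using e assms unfolding anti_def by (metis add.assoc)
  then have "2 * e dvd d + e" using double_least_anti_dvd_period[OF assms] by (simp add: e_def)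
  then obtain k where k: "d + e = 2 * e * k" by blast
  have "k \<noteq> 0" using k anti_pos[OF e] by (metis add_is_0 mult_0_right not_gr_zero)
  then obtain q where "k = Suc q" using not0_implies_Suc by blast
  then show ?thesis using k by (intro exI[of _ q]) (simp add: e_def algebra_simps)
qed

text \<open>\<open>E\<close> is the stage of the sieve: \<open>E = 1\<close> admits every
  antiperiodic sequence, and \<open>E = d\<close> leaves those whose least antiperiod is exactly
  \<open>d\<close>.\<close>

definition below :: "(nat \<Rightarrow> bool) \<Rightarrow> nat \<Rightarrow> nat \<Rightarrow> (nat \<Rightarrow> bool) set" where
  "below W d E = {y. anti d y \<and> \<not> above W y \<and> E \<le> least_anti y}"

lemma finite_words: "finite (words d)"
  and card_words: "card (words d) = 2 ^ d"
  using finite_lists_length_eq[of "UNIV :: bool set" d] card_lists_length_eq[of "UNIV :: bool set" d]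
  by (simp_all add: words_def)

lemma length_swap: "length (swap v) = length v"
  by (simp add: swap_def)

text \<open>A sequence with antiperiod \<open>d\<close> is determined by its first \<open>d\<close>
  symbols, and these are arbitrary.\<close>

lemma bij_betw_anti:
  assumes "0 < d"
  shows "bij_betw (\<lambda>v. cyc (v @ swap v)) (words d) {y. anti d y}"
proof (rule bij_betw_imageI)
  show "inj_on (\<lambda>v. cyc (v @ swap v)) (words d)"
  proof (rule inj_onI)
    fix u v assume uv: "u \<in> words d" "v \<in> words d" "cyc (u @ swap u) = cyc (v @ swap v)"
    then have "length (u @ swap u) = length (v @ swap v)" by (simp add: words_def length_swap)
    then have "u @ swap u = v @ swap v" using uv(3) cyc_eq_iff by blast
    then show "u = v" using uv(1,2) by (simp add: words_def)
  qed
  have "anti d (cyc (v @ swap v))" if "length v = d" for v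
  proof -
    have "rotate d (v @ swap v) = swap (v @ swap v)"
      using rotate_append[of v "swap v"] that by (simp add: swap_def comp_def)
    moreover have ne: "v @ swap v \<noteq> []" using that assms by auto
    ultimately show ?thesis
      unfolding anti_def by (simp only: cyc_rotate[OF ne, symmetric] cyc_swap[OF ne] simp_thms)
  qed
  moreover have "y \<in> (\<lambda>v. cyc (v @ swap v)) ` words d" if "anti d y" for y
  proof
    have "map y [d..<d + d] = map (\<lambda>i. y (i + d)) [0..<d]"
      by (rule nth_equalityI) (simp_all add: add.commute)
    also have "\<dots> = swap (map y [0..<d])"
    proof -
      have "y (i + d) = (\<not> y i)" for i using that by (simp only: anti_def)
      then show ?thesis by (simp only: swap_def map_map comp_def)
    qed
    finally have "map y [0..<d + d] = map y [0..<d] @ swap (map y [0..<d])"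
      using upt_add_eq_append[of 0 d d] by simp
    then show "y = cyc (map y [0..<d] @ swap (map y [0..<d]))"
      using cyc_map_upt[of "d + d" y] anti_period[OF that] assms by (metis add_gr_0 mult_2)
  qed (simp add: words_def)
  ultimately show "(\<lambda>v. cyc (v @ swap v)) ` words d = {y. anti d y}"
    by (auto simp: words_def)
qed

lemma finite_anti: "finite {y. anti d y}"
proof (cases "d = 0")
  case True
  then show ?thesis by (simp add: anti_def)
next
  case False
  then show ?thesis using bij_betw_finite[OF bij_betw_anti[of d]] finite_words by simp
qed

lemma finite_below: "finite (below W d E)"
  by (rule finite_subset[OF _ finite_anti[of d]]) (auto simp: below_def)

text \<open>Stage \<open>E\<close> removes the sequences with least antiperiod \<open>E\<close>.
  These have antiperiod \<open>d\<close> exactly when \<open>d\<close> is an odd multiple of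
  \<open>E\<close>, and then their number no longer depends on \<open>d\<close>.\<close>

lemma card_below_Suc:
  "card (below W d (Suc E)) =
     card (below W d E) - (if \<exists>q. d = (2 * q + 1) * E then card (below W E E) else 0)"
proof -
  define X where "X = {y. anti d y \<and> \<not> above W y \<and> least_anti y = E}"
  have "below W d E = below W d (Suc E) \<union> X" "below W d (Suc E) \<inter> X = {}"
    by (auto simp: below_def X_def)
  moreover have "finite X"
    by (rule finite_subset[OF _ finite_anti[of d]]) (auto simp: X_def)
  ultimately have "card (below W d E) = card (below W d (Suc E)) + card X"
    using card_Un_disjoint finite_below by metis
  moreover have "X = (if \<exists>q. d = (2 * q + 1) * E then below W E E else {})"
  proof (cases "\<exists>q. d = (2 * q + 1) * E")
    case True
    have "X = below W E E"
      using True anti_odd_mult anti_least_anti least_anti_le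
      by (fastforce simp: X_def below_def)
    then show ?thesis using True by simp
  next
    case False
    then show ?thesis using anti_is_odd_mult by (auto simp: X_def)
  qed
  ultimately show ?thesis by simp
qed


section \<open>Counting by pairs of states\<close>

text \<open>\<open>a\<close> and \<open>b\<close> are the current states of the copies reading
  \<open>v\<close> and \<open>swap v\<close>; \<open>r\<close> and \<open>q\<close> are their
  targets. A cyclic run closes up when \<open>a = q\<close> and \<open>b = r\<close>. Keeping
  \<open>a\<close> and \<open>b\<close> free gives a recursion on the first symbol for fixed
  \<open>q\<close> and \<open>r\<close>.\<close>

definition pair_count :: "(nat \<Rightarrow> bool) \<Rightarrow> nat \<Rightarrow> nat \<Rightarrow> nat \<Rightarrow> nat \<Rightarrow> nat \<Rightarrow> nat \<Rightarrow> nat" where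
  "pair_count W n q r i a b = card {v \<in> words i. run W n a v = r \<and> run W n b (swap v) = q}"

lemma pair_count_0: "pair_count W n q r 0 a b = of_bool (a = r \<and> b = q)"
proof -
  have "{v \<in> words 0. run W n a v = r \<and> run W n b (swap v) = q}
    = (if a = r \<and> b = q then {[]} else {})"
    by (auto simp: words_def swap_def)
  then show ?thesis by (simp add: pair_count_def)
qed

lemma pair_count_Suc:
  "pair_count W n q r (Suc i) a b =
     pair_count W n q r i (step W n a True) (step W n b False) +
     pair_count W n q r i (step W n a False) (step W n b True)"
proof -
  define S where "S a b = {v \<in> words i. run W n a v = r \<and> run W n b (swap v) = q}" for a b
  have "{v \<in> words (Suc i). run W n a v = r \<and> run W n b (swap v) = q} =
    (#) True ` S (step W n a True) (step W n b False) \<union>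
    (#) False ` S (step W n a False) (step W n b True)"
  proof (rule set_eqI)
    fix v
    show "v \<in> {v \<in> words (Suc i). run W n a v = r \<and> run W n b (swap v) = q} \<longleftrightarrow>
      v \<in> (#) True ` S (step W n a True) (step W n b False) \<union>
      (#) False ` S (step W n a False) (step W n b True)"
    proof (cases v)
      case (Cons c u)
      then show ?thesis by (cases c) (auto simp: S_def words_def swap_def)
    qed (auto simp: words_def)
  qed
  moreover have "finite (S a b)" for a b
    by (rule finite_subset[OF _ finite_words[of i]]) (auto simp: S_def)
  moreover have "card ((#) True ` A \<union> (#) False ` B) = card A + card B"
    if "finite A" "finite B" for A B
  proof -
    have "(#) True ` A \<inter> (#) False ` B = {}" by auto
    then show ?thesis using that by (simp add: card_Un_disjoint card_image)
  qed
  ultimately show ?thesis by (simp add: pair_count_def S_def)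
qed

context necklace_seq
begin

lemma cyclic_run_of_fixed_state:
  assumes "x \<noteq> []" "q < n" "run W n q x = q"
  shows "cyclic_run W n (cyc x) (length x) (\<lambda>k. run W n q (map (cyc x) [0..<k]))"
proof -
  define \<sigma> where "\<sigma> k = run W n q (map (cyc x) [0..<k])" for k
  have st: "\<sigma> (Suc k) = step W n (\<sigma> k) (cyc x k)" for k
    by (simp add: \<sigma>_def run_append)
  have per: "\<sigma> (k + length x) = \<sigma> k" for k
  proof (induction k)
    case 0
    have "map (cyc x) [0..<length x] = x"
      by (rule nth_equalityI) (auto simp: cyc_nth)
    then show ?case using assms by (simp add: \<sigma>_def)
  next
    case (Suc k)
    then show ?case using st[of k] st[of "k + length x"] cyc_period[of x k] by simp
  qed
  have le: "\<sigma> k \<le> n" for k unfolding \<sigma>_def by (rule run_le) (use assms in simp)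
  have "\<sigma> k < n" for k
  proof (rule ccontr)
    assume "\<not> \<sigma> k < n"
    \<comment> \<open>The sink is absorbing, so the run would still be in it at time
      \<open>length x * k\<close>, where periodicity returns it to its initial state
      \<open>q < n\<close>.\<close>
    then have k: "\<sigma> k = n" using le[of k] by simp
    have "\<sigma> (k + j) = n" for j
      by (induction j) (simp_all add: k st step_def)
    moreover have "0 + length x * k = k + (length x - 1) * k"
      using assms(1) by (cases x) auto
    ultimately have "\<sigma> 0 = n" using periodic_mult[of \<sigma> "length x" 0 k] per by metis
    then show False using assms by (simp add: \<sigma>_def)
  qed
  then show ?thesis using st per unfolding cyclic_run_def \<sigma>_def by blast
qed

lemma fixed_state_unique:
  assumes "x \<noteq> []" "q < n" "run W n q x = q" "r < n" "run W n r x = r"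
  shows "q = r"
proof -
  have "(\<lambda>k. run W n q (map (cyc x) [0..<k])) = (\<lambda>k. run W n r (map (cyc x) [0..<k]))"
    using cyclic_run_unique[OF _ cyclic_run_of_fixed_state[OF assms(1-3)]
        cyclic_run_of_fixed_state[OF assms(1,4,5)]] assms(1) by blast
  from fun_cong[OF this, of 0] show ?thesis by simp
qed

lemma above_iff_fixed_state:
  assumes "x \<noteq> []" "length x \<le> n"
  shows "above W (cyc x) \<longleftrightarrow> (\<exists>q<n. run W n q x = q)"
proof
  assume "above W (cyc x)"
  then obtain \<sigma> where \<sigma>: "cyclic_run W n (cyc x) (length x) \<sigma>"
    using cyclic_run_if_above[of "length x" "cyc x"] cyc_period assms by auto
  have "run W n (\<sigma> 0) (map (cyc x) [0..<k]) = \<sigma> k" for k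
    by (induction k) (use \<sigma> in \<open>auto simp: run_append cyclic_run_def\<close>)
  moreover have "map (cyc x) [0..<length x] = x"
    by (rule nth_equalityI) (auto simp: cyc_nth)
  moreover have "\<sigma> (length x) = \<sigma> 0" "\<sigma> 0 < n"
    using \<sigma> unfolding cyclic_run_def by (metis add_0)+
  ultimately show "\<exists>q<n. run W n q x = q" by metis
next
  assume "\<exists>q<n. run W n q x = q"
  then show "above W (cyc x)"
    using above_if_cyclic_run cyclic_run_of_fixed_state assms by blast
qed

text \<open>The sets for different pairs are disjoint: \<open>q\<close> is the unique fixed state of
  \<open>v @ swap v\<close>, and \<open>r\<close> is where \<open>v\<close> leads from
  \<open>q\<close>.\<close>

lemma card_above:
  assumes "0 < d" "2 * d \<le> n"
  shows "card {v \<in> words d. above W (cyc (v @ swap v))} = (\<Sum>q<n. \<Sum>r<n. pair_count W n q r d q r)"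
proof -
  define S where "S q r = {v \<in> words d. run W n q v = r \<and> run W n r (swap v) = q}" for q r
  have fin: "finite (S q r)" for q r
    by (rule finite_subset[OF _ finite_words[of d]]) (auto simp: S_def)
  have len: "v @ swap v \<noteq> []" "length (v @ swap v) \<le> n" if "v \<in> words d" for v
    using that assms by (auto simp: words_def length_swap)
  have disj: "(q, r) = (q', r')" if "v \<in> S q r" "v \<in> S q' r'" "q < n" "q' < n" for v q r q' r'
  proof -
    have "q = q'"
      by (rule fixed_state_unique[of "v @ swap v"]) (use that len in \<open>auto simp: S_def run_append\<close>)
    then show ?thesis using that by (auto simp: S_def)
  qed
  have "{v \<in> words d. above W (cyc (v @ swap v))} = (\<Union>p\<in>{..<n} \<times> {..<n}. S (fst p) (snd p))"
  proof (rule set_eqI)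
    fix v
    \<comment> \<open>The middle state cannot be the sink, which \<open>swap v\<close> would not
      leave.\<close>
    have r: "run W n q v < n" if "q < n" "run W n (run W n q v) (swap v) = q" for q
      using that run_le[of q n W v] run_sink[of W n "swap v"] by (cases "run W n q v = n") auto
    have "v \<in> words d \<and> above W (cyc (v @ swap v)) \<longleftrightarrow>
      v \<in> words d \<and> (\<exists>q<n. run W n (run W n q v) (swap v) = q)"
      using above_iff_fixed_state[OF len] by (auto simp: run_append)
    also have "\<dots> \<longleftrightarrow> v \<in> (\<Union>p\<in>{..<n} \<times> {..<n}. S (fst p) (snd p))"
      using r by (auto simp: S_def)
    finally show "v \<in> {v \<in> words d. above W (cyc (v @ swap v))} \<longleftrightarrow>
      v \<in> (\<Union>p\<in>{..<n} \<times> {..<n}. S (fst p) (snd p))" by simp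
  qed
  also have "card \<dots> = (\<Sum>p\<in>{..<n} \<times> {..<n}. card (S (fst p) (snd p)))"
  proof (rule card_UN_disjoint)
    show "\<forall>p\<in>{..<n} \<times> {..<n}. \<forall>p'\<in>{..<n} \<times> {..<n}. p \<noteq> p' \<longrightarrow>
      S (fst p) (snd p) \<inter> S (fst p') (snd p') = {}"
      using disj by (fastforce simp: disjoint_iff)
  qed (use fin in auto)
  also have "\<dots> = (\<Sum>q<n. \<Sum>r<n. card (S q r))"
    by (simp add: sum.cartesian_product case_prod_unfold)
  finally show ?thesis by (simp add: S_def pair_count_def)
qed

lemma card_below_1:
  assumes "0 < d" "2 * d \<le> n"
  shows "card (below W d 1) = 2 ^ d - (\<Sum>q<n. \<Sum>r<n. pair_count W n q r d q r)"
proof -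
  define f where "f v = cyc (v @ swap v)" for v
  define A where "A = {v \<in> words d. above W (f v)}"
  have img: "f ` words d = {y. anti d y}" and inj: "inj_on f (words d)"
    using bij_betw_anti[OF assms(1)] unfolding bij_betw_def f_def by simp_all
  have "anti d y \<Longrightarrow> 1 \<le> least_anti y" for y
    using anti_pos[OF anti_least_anti] by (simp add: Suc_leI)
  then have "below W d 1 = {y. anti d y} - f ` A"
    using img unfolding below_def A_def by auto
  moreover have "f ` A \<subseteq> {y. anti d y}"
    using img unfolding A_def by blast
  moreover have "card {y. anti d y} = 2 ^ d"
    using bij_betw_same_card[OF bij_betw_anti[OF assms(1)]] card_words by simp
  moreover have "card (f ` A) = card A"
    using inj by (intro card_image) (auto simp: A_def intro: inj_on_subset)
  ultimately show ?thesis
    using card_above[OF assms] finite_anti[of d]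
    by (simp add: card_Diff_subset finite_subset A_def f_def)
qed

end


section \<open>Ranking symmetric necklaces\<close>

definition necklace_of :: "word \<Rightarrow> word set" where
  "necklace_of x = rotation_rel `` {x}"

lemma in_necklace_of: "z \<in> necklace_of x \<longleftrightarrow> (\<exists>k. z = rotate k x)"
  by (simp add: necklace_of_def rotation_rel_def)

lemma self_in_necklace_of: "x \<in> necklace_of x"
  unfolding in_necklace_of by (rule exI[of _ 0]) simp

lemma necklace_of_eq: "z \<in> necklace_of x \<Longrightarrow> necklace_of z = necklace_of x"
  unfolding necklace_of_def
  using equiv_class_eq[OF equiv_rotation_rel, of x z] by simp

lemma necklace_length: "z \<in> necklace_of x \<Longrightarrow> length z = length x"
  by (auto simp: in_necklace_of)

lemma necklaces_iff: "N \<in> necklaces m \<longleftrightarrow> (\<exists>x. length x = m \<and> N = necklace_of x)"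
  by (auto simp: necklaces_def quotient_def words_def necklace_of_def)

lemma finite_necklace_of: "finite (necklace_of x)"
  by (rule finite_subset[OF _ finite_words[of "length x"]]) (auto simp: necklace_length words_def)

lemma finite_necklaces: "finite (necklaces m)"
proof -
  have "necklaces m = necklace_of ` words m"
    by (auto simp: necklaces_iff words_def)
  then show ?thesis using finite_words by simp
qed

lemma canonical_in: "canonical (necklace_of x) \<in> necklace_of x"
  unfolding canonical_def using self_in_necklace_of
  by (intro Min_in finite_necklace_of) blast

lemma canonical_le: "z \<in> necklace_of x \<Longrightarrow> canonical (necklace_of x) \<le> z"
  unfolding canonical_def by (intro Min_le finite_necklace_of)

section \<open>Invariance under rotation\<close>

lemma cyc_rotate_length: "x \<noteq> [] \<Longrightarrow> cyc (rotate k x) = (\<lambda>i. cyc x (i + k))"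
  using cyc_rotate by blast

lemma shift_back:
  fixes y :: "nat \<Rightarrow> 'a"
  assumes "\<And>i. y (i + p) = y i" "0 < p"
  obtains j where "(\<lambda>i. y (i + k + j)) = y"
proof -
  have "y (i + k + (p * k - k)) = y i" for i
  proof -
    have "k \<le> p * k" using assms(2) by (cases p) auto
    then have "i + k + (p * k - k) = i + p * k" by simp
    then show ?thesis using periodic_mult[of y p i k, OF assms(1)] by (simp only:)
  qed
  then show thesis using that[of "p * k - k"] by blast
qed

lemma above_shift:
  assumes "\<And>i. y (i + p) = y i" "0 < p"
  shows "above W (\<lambda>i. y (i + k)) \<longleftrightarrow> above W y"
proof
  assume ab: "above W (\<lambda>i. y (i + k))"
  show "above W y" unfolding above_def
  proof
    fix l
    obtain j where "(\<lambda>i. y (i + k + j)) = y" using shift_back[of y p k, OF assms] by blast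
    then have "(\<lambda>i. y (i + l)) = (\<lambda>i. y (i + (l + j) + k))"
      by (metis add.commute add.left_commute)
    then show "seq_less W (\<lambda>i. y (i + l))" using ab unfolding above_def by metis
  qed
next
  assume ab: "above W y"
  have "seq_less W (\<lambda>i. y (i + l + k))" for l
    using ab unfolding above_def by (simp only: add.assoc)
  then show "above W (\<lambda>i. y (i + k))" unfolding above_def by blast
qed

lemma anti_shift:
  assumes "\<And>i. y (i + p) = y i" "0 < p"
  shows "anti d (\<lambda>i. y (i + k)) \<longleftrightarrow> anti d y"
proof
  assume a: "anti d (\<lambda>i. y (i + k))"
  obtain j where j: "(\<lambda>i. y (i + k + j)) = y" using shift_back[of y p k, OF assms] by blast
  show "anti d y" unfolding anti_def
  proof
    fix i
    have "y (i + d) = y (i + j + d + k)" using fun_cong[OF j, of "i + d"] by (simp add: ac_simps)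
    also have "\<dots> = (\<not> y (i + j + k))" using a unfolding anti_def by blast
    also have "y (i + j + k) = y i" using fun_cong[OF j, of i] by (simp add: ac_simps)
    finally show "y (i + d) \<longleftrightarrow> \<not> y i" .
  qed
next
  assume a: "anti d y"
  have "y (i + d + k) = (\<not> y (i + k))" for i
    using a[unfolded anti_def, rule_format, of "i + k"] by (simp add: ac_simps)
  then show "anti d (\<lambda>i. y (i + k))" unfolding anti_def by blast
qed

lemma necklace_invariants:
  assumes "z \<in> necklace_of x" "x \<noteq> []"
  shows "above W (cyc z) \<longleftrightarrow> above W (cyc x)"
    and "anti d (cyc z) \<longleftrightarrow> anti d (cyc x)"
    and "least_anti (cyc z) = least_anti (cyc x)"
proof -
  obtain k where k: "cyc z = (\<lambda>i. cyc x (i + k))"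
    using assms cyc_rotate_length by (auto simp: in_necklace_of)
  have l: "0 < length x" using assms by simp
  show "above W (cyc z) \<longleftrightarrow> above W (cyc x)"
    unfolding k by (rule above_shift[of "cyc x" "length x", OF cyc_period l])
  have *: "anti d (cyc z) \<longleftrightarrow> anti d (cyc x)" for d
    unfolding k by (rule anti_shift[of "cyc x" "length x", OF cyc_period l])
  then show "anti d (cyc z) \<longleftrightarrow> anti d (cyc x)" "least_anti (cyc z) = least_anti (cyc x)"
    by (simp_all add: least_anti_def)
qed

section \<open>Symmetric necklaces and antiperiods\<close>

lemma swap_rotate_iff_anti:
  assumes "x \<noteq> []"
  shows "rotate d x = swap x \<longleftrightarrow> anti d (cyc x)"
proof -
  have "rotate d x = swap x \<longleftrightarrow> cyc (rotate d x) = cyc (swap x)"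
    by (rule cyc_eq_iff[symmetric]) (simp add: length_swap)
  also have "\<dots> \<longleftrightarrow> anti d (cyc x)"
    by (simp add: anti_def fun_eq_iff cyc_rotate[OF assms] cyc_swap[OF assms])
  finally show ?thesis .
qed

text \<open>Swapping carries the necklace of \<open>x\<close> onto that of \<open>swap x\<close>, so
  symmetry means that \<open>swap x\<close> is a rotation of \<open>x\<close>; the amount of that
  rotation is an antiperiod.\<close>

lemma symmetric_necklace_iff_anti:
  assumes "x \<noteq> []"
  shows "symmetric_necklace (necklace_of x) \<longleftrightarrow> (\<exists>d. anti d (cyc x))"
proof -
  have sw: "swap ` necklace_of x = necklace_of (swap x)"
  proof -
    have "necklace_of z = range (\<lambda>k. rotate k z)" for z
      by (auto simp: in_necklace_of)
    then show ?thesis by (simp add: image_image swap_def rotate_map)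
  qed
  have "symmetric_necklace (necklace_of x) \<longleftrightarrow> swap x \<in> necklace_of x"
    unfolding symmetric_necklace_def sw
    using self_in_necklace_of[of "swap x"] necklace_of_eq[of "swap x" x] by auto
  also have "\<dots> \<longleftrightarrow> (\<exists>d. rotate d x = swap x)"
    by (auto simp: in_necklace_of) metis
  finally show ?thesis using swap_rotate_iff_anti[OF assms] by simp
qed

text \<open>Two rotations agree iff their amounts agree modulo the least period of
  \<open>cyc x\<close>, which is twice the least antiperiod.\<close>

lemma card_necklace_of:
  assumes "x \<noteq> []" "anti d (cyc x)"
  shows "card (necklace_of x) = 2 * least_anti (cyc x)"
proof -
  define y where "y = cyc x"
  define p where "p = 2 * least_anti y"
  have y: "anti d y" using assms by (simp add: y_def)
  have p: "y (i + p) = y i" for i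
    using anti_period[OF anti_least_anti[OF y]] unfolding p_def by blast
  have "0 < p" using anti_pos[OF anti_least_anti[OF y]] by (simp add: p_def)
  have rot: "rotate i x = rotate j x \<longleftrightarrow> (\<lambda>l. y (l + i)) = (\<lambda>l. y (l + j))" for i j
    using cyc_eq_iff[of "rotate i x" "rotate j x"] assms(1)
    by (simp add: cyc_rotate_length y_def)
  have "necklace_of x = (\<lambda>k. rotate k x) ` {..<p}"
  proof (intro set_eqI iffI)
    fix z assume "z \<in> necklace_of x"
    then obtain k where z: "z = rotate k x" by (auto simp: in_necklace_of)
    have "y (l + k) = y (l + k mod p)" for l
      using periodic_mult[of y p "l + k mod p" "k div p", OF p] by (simp add: add.assoc)
    then have "z = rotate (k mod p) x" unfolding z rot by blast
    then show "z \<in> (\<lambda>k. rotate k x) ` {..<p}" using \<open>0 < p\<close> by simp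
  qed (auto simp: in_necklace_of)
  moreover have "inj_on (\<lambda>k. rotate k x) {..<p}"
  proof (rule linorder_inj_onI)
    fix i j assume ij: "i < j" "i \<in> {..<p}" "j \<in> {..<p}"
    show "rotate i x \<noteq> rotate j x"
    proof
      assume "rotate i x = rotate j x"
      then have eq: "(\<lambda>l. y (l + i)) = (\<lambda>l. y (l + j))" using rot by blast
      obtain h where h: "(\<lambda>l. y (l + i + h)) = y" using shift_back[of y p i, OF p \<open>0 < p\<close>] by blast
      have "y (l + (j - i)) = y l" for l
      proof -
        have "y (l + (j - i)) = y (l + (j - i) + i + h)" using fun_cong[OF h, of "l + (j - i)"] by simp
        also have "l + (j - i) + i + h = l + h + j" using ij by simp
        also have "y (l + h + j) = y (l + h + i)" using fun_cong[OF eq, of "l + h"] by simp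
        also have "\<dots> = y l" using fun_cong[OF h, of l] by (simp add: ac_simps)
        finally show ?thesis .
      qed
      then have "p \<le> j - i" using period_ge_least_anti[OF y, of "j - i"] ij unfolding p_def by simp
      then show False using ij by simp
    qed
  qed auto
  ultimately show ?thesis by (simp add: card_image p_def y_def)
qed

text \<open>The necklaces with least antiperiod \<open>e\<close> partition a set of words that
  \<open>cyc\<close> maps bijectively onto \<open>below W e e\<close>, and each of them has
  \<open>2 * e\<close> elements. So \<open>m\<close> enters through the divisibility condition
  alone.\<close>

lemma card_symmetric_below:
  assumes m: "0 < m"
  shows "card {N \<in> necklaces m. symmetric_necklace N \<and> (\<forall>x\<in>N. \<not> above W (cyc x))} =
    (\<Sum>e\<in>{1..m}. if 2 * e dvd m then card (below W e e) div (2 * e) else 0)"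
proof -
  define S where "S = {N \<in> necklaces m. symmetric_necklace N \<and> (\<forall>x\<in>N. \<not> above W (cyc x))}"
  define P where "P e = {N \<in> S. \<forall>x\<in>N. least_anti (cyc x) = e}" for e
  define E where "E = {e \<in> {1..m}. 2 * e dvd m}"
  have nonempty: "x \<noteq> []" if "length x = m" for x :: word using that m by auto
  have S: "N \<in> S \<longleftrightarrow> (\<exists>x. length x = m \<and> N = necklace_of x \<and> (\<exists>d. anti d (cyc x))
      \<and> \<not> above W (cyc x))" for N
  proof
    assume "N \<in> S"
    then obtain x where x: "length x = m" "N = necklace_of x" "symmetric_necklace N"
      "\<forall>z\<in>N. \<not> above W (cyc z)" unfolding S_def necklaces_iff by blast
    then show "\<exists>x. length x = m \<and> N = necklace_of x \<and> (\<exists>d. anti d (cyc x)) \<and> \<not> above W (cyc x)"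
      using symmetric_necklace_iff_anti[OF nonempty[OF x(1)]] self_in_necklace_of[of x]
      by (intro exI[of _ x]) simp
  next
    assume "\<exists>x. length x = m \<and> N = necklace_of x \<and> (\<exists>d. anti d (cyc x)) \<and> \<not> above W (cyc x)"
    then obtain x where x: "length x = m" "N = necklace_of x" "\<exists>d. anti d (cyc x)"
      "\<not> above W (cyc x)" by blast
    have "x \<noteq> []" using nonempty x(1) .
    then show "N \<in> S" unfolding S_def
      using x symmetric_necklace_iff_anti[of x] necklace_invariants(1)[of _ x W]
      by (auto simp: necklaces_iff)
  qed
  have P: "N \<in> P e \<longleftrightarrow> (\<exists>x. length x = m \<and> N = necklace_of x \<and> anti e (cyc x) \<and>
      least_anti (cyc x) = e \<and> \<not> above W (cyc x))" for N e
  proof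
    assume "N \<in> P e"
    then have "N \<in> S" and la: "\<forall>x\<in>N. least_anti (cyc x) = e" by (auto simp: P_def)
    from \<open>N \<in> S\<close> obtain x d where x: "length x = m" "N = necklace_of x" "anti d (cyc x)"
      "\<not> above W (cyc x)" unfolding S by blast
    then have "least_anti (cyc x) = e" using la self_in_necklace_of by blast
    then show "\<exists>x. length x = m \<and> N = necklace_of x \<and> anti e (cyc x) \<and>
      least_anti (cyc x) = e \<and> \<not> above W (cyc x)"
      using x anti_least_anti by (intro exI[of _ x]) auto
  next
    assume "\<exists>x. length x = m \<and> N = necklace_of x \<and> anti e (cyc x) \<and>
      least_anti (cyc x) = e \<and> \<not> above W (cyc x)"
    then obtain x where x: "length x = m" "N = necklace_of x" "anti e (cyc x)"
      "least_anti (cyc x) = e" "\<not> above W (cyc x)" by blast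
    then have "N \<in> S" unfolding S by blast
    then show "N \<in> P e" unfolding P_def
      using x necklace_invariants(3)[OF _ nonempty[OF x(1)]] by auto
  qed
  have finS: "finite S" by (rule finite_subset[OF _ finite_necklaces[of m]]) (auto simp: S_def)
  have "S = (\<Union>e\<in>E. P e)"
  proof
    show "S \<subseteq> (\<Union>e\<in>E. P e)"
    proof
      fix N assume "N \<in> S"
      then obtain x d where x: "length x = m" "N = necklace_of x" "anti d (cyc x)"
        "\<not> above W (cyc x)" unfolding S by blast
      define e where "e = least_anti (cyc x)"
      have e: "anti e (cyc x)" unfolding e_def by (rule anti_least_anti[OF x(3)])
      have "2 * e dvd m"
        using double_least_anti_dvd_period[OF x(3), of m] cyc_period[of x] x(1)
        unfolding e_def by simp
      moreover from this have "2 * e \<le> m" using m by (rule dvd_imp_le)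
      ultimately have "e \<in> E" using anti_pos[OF e] by (simp add: E_def)
      moreover have "N \<in> P e" unfolding P using x e e_def by blast
      ultimately show "N \<in> (\<Union>e\<in>E. P e)" by blast
    qed
  qed (auto simp: P_def)
  moreover have "card (\<Union>e\<in>E. P e) = (\<Sum>e\<in>E. card (P e))"
  proof (rule card_UN_disjoint)
    show "finite E" by (simp add: E_def)
    show "\<forall>e\<in>E. finite (P e)" using finS by (simp add: P_def)
    have "P e \<inter> P e' = {}" if "e \<noteq> e'" for e e'
    proof (rule ccontr)
      assume "P e \<inter> P e' \<noteq> {}"
      then obtain N where N: "N \<in> P e" "N \<in> P e'" by blast
      then obtain x where "N = necklace_of x" unfolding P by blast
      then have "x \<in> N" using self_in_necklace_of by simp
      then have "least_anti (cyc x) = e" "least_anti (cyc x) = e'" using N unfolding P_def by blast+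
      then show False using that by simp
    qed
    then show "\<forall>i\<in>E. \<forall>j\<in>E. i \<noteq> j \<longrightarrow> P i \<inter> P j = {}" by blast
  qed
  moreover have "card (P e) = card (below W e e) div (2 * e)" if "e \<in> E" for e
  proof -
    have e: "0 < e" "2 * e dvd m" using that by (auto simp: E_def)
    have un: "\<Union>(P e) = {x \<in> words m. anti e (cyc x) \<and> least_anti (cyc x) = e \<and> \<not> above W (cyc x)}"
      (is "_ = ?X")
    proof
      show "\<Union>(P e) \<subseteq> ?X"
      proof
        fix z assume "z \<in> \<Union>(P e)"
        then obtain N where "N \<in> P e" "z \<in> N" by blast
        then obtain x where x: "length x = m" "z \<in> necklace_of x" "anti e (cyc x)"
          "least_anti (cyc x) = e" "\<not> above W (cyc x)" unfolding P by blast
        then show "z \<in> ?X"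
          using necklace_invariants[OF x(2) nonempty[OF x(1)]] necklace_length[OF x(2)]
          by (simp add: words_def)
      qed
      show "?X \<subseteq> \<Union>(P e)"
      proof
        fix x assume "x \<in> ?X"
        then have "necklace_of x \<in> P e" unfolding P words_def by blast
        then show "x \<in> \<Union>(P e)" using self_in_necklace_of by blast
      qed
    qed
    have "2 * e * card (P e) = card (\<Union>(P e))"
    proof (rule card_partition)
      show "finite (P e)" using finS by (simp add: P_def)
      show "finite (\<Union>(P e))" unfolding un using finite_words by simp
      fix N assume "N \<in> P e"
      then obtain x where "length x = m" "N = necklace_of x" "anti e (cyc x)" "least_anti (cyc x) = e"
        unfolding P by blast
      then show "card N = 2 * e" using card_necklace_of nonempty by blast
    next
      fix N N' assume NN: "N \<in> P e" "N' \<in> P e" "N \<noteq> N'"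
      then obtain x x' where x: "N = necklace_of x" "N' = necklace_of x'" unfolding P by blast
      show "N \<inter> N' = {}"
      proof (rule ccontr)
        assume "N \<inter> N' \<noteq> {}"
        then obtain z where "z \<in> N" "z \<in> N'" by blast
        then have "N = N'" using necklace_of_eq[of z x] necklace_of_eq[of z x'] x by simp
        then show False using NN by simp
      qed
    qed
    also have "card (\<Union>(P e)) = card (below W e e)"
    proof -
      have "inj_on cyc (\<Union>(P e))" unfolding un words_def
        by (intro inj_onI) (simp, metis cyc_eq_iff)
      moreover have "cyc ` \<Union>(P e) = below W e e"
      proof
        show "cyc ` \<Union>(P e) \<subseteq> below W e e" unfolding un below_def by auto
        show "below W e e \<subseteq> cyc ` \<Union>(P e)"
        proof
          fix y assume y: "y \<in> below W e e"
          then have ya: "anti e y" by (simp add: below_def)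
          \<comment> \<open>Since \<open>2 * e\<close> divides \<open>m\<close>, the sequence has
            period \<open>m\<close> and is the extension of a word of length
            \<open>m\<close>.\<close>
          obtain k where k: "m = 2 * e * k" using e by blast
          have per: "y (i + m) = y i" for i
            unfolding k by (rule periodic_mult) (rule anti_period[OF ya])
          have eq: "cyc (map y [0..<m]) = y" by (rule cyc_map_upt[of m y, OF m per])
          have "\<not> above W y" "least_anti y = e"
            using y least_anti_le[OF ya] by (auto simp: below_def)
          then have "map y [0..<m] \<in> \<Union>(P e)" unfolding un
            using ya by (simp add: eq words_def)
          then show "y \<in> cyc ` \<Union>(P e)" using eq by (metis imageI)
        qed
      qed
      ultimately show ?thesis using card_image by metis
    qed
    finally show ?thesis using e by (metis mult_eq_0_iff nonzero_mult_div_cancel_left not_gr_zero zero_neq_numeral)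
  qed
  ultimately have "card S = (\<Sum>e\<in>E. card (below W e e) div (2 * e))" by simp
  also have "\<dots> = (\<Sum>e\<in>{1..m}. if 2 * e dvd m then card (below W e e) div (2 * e) else 0)"
    unfolding E_def by (rule sum.inter_filter) simp
  finally show ?thesis unfolding S_def .
qed

text \<open>The unlabelled class of \<open>w\<close> contains all its rotations, so its least
  element is least among them too.\<close>

lemma le_rotate_if_canonical:
  assumes "w \<in> words n" "U \<in> unlabelled_necklaces n" "w = canonical U"
  shows "w \<le> rotate k w"
proof -
  obtain x where x: "length x = n" "U = unlabelled_rel `` {x}"
    using assms(2) by (auto simp: unlabelled_necklaces_def quotient_def words_def)
  have "U \<subseteq> words n"
    using x by (auto simp: unlabelled_rel_def words_def length_swap)
  then have fin: "finite U" using finite_words finite_subset by blast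
  have "x \<in> U" using equiv_class_self[OF equiv_unlabelled_rel, of x] x by simp
  then have "w \<in> U" using assms(3) fin unfolding canonical_def by (metis Min_in empty_iff)
  then have U: "U = unlabelled_rel `` {w}"
    using x equiv_class_eq[OF equiv_unlabelled_rel, of x w] by simp
  have "(w, rotate k w) \<in> unlabelled_rel" by (auto simp: unlabelled_rel_def)
  then have "rotate k w \<in> U" using U by simp
  then show ?thesis using fin assms(3) unfolding canonical_def by simp
qed

lemma necklace_seq_if_le_rotate:
  assumes "w \<noteq> []" "\<And>k. w \<le> rotate k w"
  shows "necklace_seq (cyc w)"
proof
  fix k
  have "\<not> rotate k w < w" using assms(2) by (simp add: not_less)
  then show "\<not> seq_less (\<lambda>i. cyc w (i + k)) (cyc w)"
    using less_iff_cyc[of "rotate k w" w] cyc_rotate_length[OF assms(1)] by simp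
qed

lemma RankSN_eq_sum:
  assumes "w \<noteq> []" "\<And>k. w \<le> rotate k w" "0 < m" "m \<le> length w"
  shows "RankSN w m + of_bool (m = length w \<and> (\<exists>d. anti d (cyc w))) =
    (\<Sum>e\<in>{1..m}. if 2 * e dvd m then card (below (cyc w) e e) div (2 * e) else 0)"
proof -
  define W where "W = cyc w"
  define S where "S = {N \<in> necklaces m. symmetric_necklace N \<and> (\<forall>x\<in>N. \<not> above W (cyc x))}"
  define R where "R = {N \<in> necklaces m. symmetric_necklace N \<and> word_less (canonical N) w}"
  define T where "T = {N \<in> necklaces m. symmetric_necklace N \<and> m = length w \<and> canonical N = w}"
  have low: "(\<forall>x\<in>N. \<not> above W (cyc x)) \<longleftrightarrow>
      word_less (canonical N) w \<or> (m = length w \<and> canonical N = w)" if Nm: "N \<in> necklaces m" for N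
  proof -
    define c where "c = canonical N"
    obtain x where x: "length x = m" "N = necklace_of x" using Nm by (auto simp: necklaces_iff)
    have cN: "c \<in> N" unfolding c_def x(2) by (rule canonical_in)
    have N: "N = necklace_of c" using cN necklace_of_eq[of c x] x(2) by simp
    have lc: "length c = m" using cN necklace_length[of c x] x by simp
    then have cne: "c \<noteq> []" using assms(3) by auto
    have "(\<forall>x\<in>N. \<not> above W (cyc x)) \<longleftrightarrow> \<not> above W (cyc c)"
    proof -
      have "above W (cyc z) \<longleftrightarrow> above W (cyc c)" if "z \<in> N" for z
        using that unfolding N by (rule necklace_invariants(1)[OF _ cne])
      then show ?thesis using cN by blast
    qed
    \<comment> \<open>As \<open>c\<close> is the least rotation, all shifts lie above
      \<open>W\<close> as soon as \<open>cyc c\<close> does.\<close>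
    also have "\<dots> \<longleftrightarrow> \<not> seq_less W (cyc c)"
    proof
      assume "\<not> above W (cyc c)"
      then obtain k where k: "\<not> seq_less W (\<lambda>i. cyc c (i + k))" unfolding above_def by blast
      have "rotate k c \<in> N" unfolding N in_necklace_of by blast
      then have "\<not> rotate k c < c" using canonical_le x unfolding c_def by (simp add: not_less)
      then have "\<not> seq_less (\<lambda>i. cyc c (i + k)) (cyc c)"
        using less_iff_cyc[of "rotate k c" c] cyc_rotate_length[OF cne] by simp
      then show "\<not> seq_less W (cyc c)"
        using k seq_less_linear[of "\<lambda>i. cyc c (i + k)" "cyc c"]
          seq_less_trans[of W "cyc c" "\<lambda>i. cyc c (i + k)"] by metis
    next
      assume "\<not> seq_less W (cyc c)"
      moreover have "(\<lambda>i. cyc c (i + 0)) = cyc c" by simp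
      ultimately show "\<not> above W (cyc c)" unfolding above_def by metis
    qed
    also have "\<dots> \<longleftrightarrow> seq_less (cyc c) W \<or> cyc c = W"
      using seq_less_linear[of W "cyc c"] seq_less_asym[of W "cyc c"] seq_less_irrefl[of W] by auto
    \<comment> \<open>When the extensions are equal, a shorter \<open>c\<close> counts as smaller;
      for \<open>m = length w\<close> equality means \<open>c = w\<close>, the one case that
      \<open>RankSN\<close> leaves out.\<close>
    also have "\<dots> \<longleftrightarrow> word_less c w \<or> (m = length w \<and> c = w)"
      using word_less_iff_cyc[OF cne assms(1)] assms(4) lc cyc_eq_iff[of c w]
      unfolding W_def by auto
    finally show ?thesis unfolding c_def .
  qed
  have "S = R \<union> T" using low unfolding S_def R_def T_def by blast
  moreover have "R \<inter> T = {}" by (auto simp: R_def T_def word_less_def)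
  moreover have "finite R" "finite T"
    by (rule finite_subset[OF _ finite_necklaces[of m]]; auto simp: R_def T_def)+
  ultimately have "card S = card R + card T" by (simp add: card_Un_disjoint)
  moreover have "card T = of_bool (m = length w \<and> (\<exists>d. anti d (cyc w)))"
  proof -
    have "canonical (necklace_of w) = w"
    proof (rule antisym)
      show "canonical (necklace_of w) \<le> w" by (rule canonical_le[OF self_in_necklace_of])
      show "w \<le> canonical (necklace_of w)"
        using canonical_in[of w] assms(2) by (auto simp: in_necklace_of)
    qed
    moreover have uniq: "N = necklace_of w" if "N \<in> necklaces m" "canonical N = w" for N
      using that canonical_in necklace_of_eq by (metis necklaces_iff)
    moreover have "necklace_of w \<in> necklaces (length w)" by (auto simp: necklaces_iff)
    ultimately have "N \<in> T \<longleftrightarrow>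
        m = length w \<and> symmetric_necklace (necklace_of w) \<and> N = necklace_of w" for N
      unfolding T_def by (cases "N = necklace_of w") auto
    then have "T = (if m = length w \<and> symmetric_necklace (necklace_of w)
        then {necklace_of w} else {})" by auto
    then show ?thesis using symmetric_necklace_iff_anti[OF assms(1)] by simp
  qed
  moreover have "card R = RankSN w m" by (simp add: R_def RankSN_def)
  ultimately show ?thesis using card_symmetric_below[OF assms(3), of W] unfolding S_def W_def by simp
qed


section \<open>Verifying programs together with their running time\<close>

text \<open>\<open>worst_cost N c\<close> bounds the cost of \<open>c\<close> when every loop makes at most \<open>N\<close> iterations per
  entry, so that the exponent of the running time is the nesting depth of the loops.\<close>

fun worst_cost :: "nat \<Rightarrow> com \<Rightarrow> nat" where
  "worst_cost N Skip = 1"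
| "worst_cost N (Assign x e) = 1 + acost e"
| "worst_cost N (Write y e f) = 1 + acost e + acost f"
| "worst_cost N (Seq c d) = worst_cost N c + worst_cost N d"
| "worst_cost N (Ite b c d) = 1 + bcost b + worst_cost N c + worst_cost N d"
| "worst_cost N (While b c) = Suc N * (1 + bcost b + worst_cost N c)"

fun depth :: "com \<Rightarrow> nat" where
  "depth (Seq c d) = max (depth c) (depth d)"
| "depth (Ite b c d) = max (depth c) (depth d)"
| "depth (While b c) = Suc (depth c)"
| "depth _ = 0"

lemma le_power_depth:
  assumes "a \<le> K * Suc N ^ i" "i \<le> j"
  shows "a \<le> K * Suc N ^ j"
proof -
  have "Suc N ^ i \<le> Suc N ^ j" by (rule power_increasing) (use assms in auto)
  then show ?thesis using assms(1) mult_le_mono2 order_trans by blast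
qed

text \<open>The base \<open>Suc N\<close> is at least \<open>1\<close>, so the power for the greater
  depth dominates the costs of the shallower parts.\<close>

lemma worst_cost_poly: "\<exists>K. \<forall>N. worst_cost N c \<le> K * Suc N ^ depth c"
proof (induction c)
  case (Seq c d)
  then obtain K L where "\<And>N. worst_cost N c \<le> K * Suc N ^ depth c"
    "\<And>N. worst_cost N d \<le> L * Suc N ^ depth d" by blast
  then have "worst_cost N c + worst_cost N d \<le> (K + L) * Suc N ^ depth (Seq c d)" for N
    unfolding add_mult_distrib
    by (intro add_mono) (rule le_power_depth, assumption, simp)+
  then show ?case unfolding worst_cost.simps by blast
next
  case (Ite b c d)
  then obtain K L where "\<And>N. worst_cost N c \<le> K * Suc N ^ depth c"
    "\<And>N. worst_cost N d \<le> L * Suc N ^ depth d" by blast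
  moreover have "1 + bcost b \<le> (1 + bcost b) * Suc N ^ 0" for N by simp
  ultimately have "1 + bcost b + worst_cost N c + worst_cost N d \<le>
      (1 + bcost b + K + L) * Suc N ^ depth (Ite b c d)" for N
    unfolding add_mult_distrib[of _ K] add_mult_distrib[of _ L]
    by (intro add_mono) (rule le_power_depth, assumption, simp)+
  then show ?case unfolding worst_cost.simps by blast
next
  case (While b c)
  then obtain K where K: "\<And>N. worst_cost N c \<le> K * Suc N ^ depth c" by blast
  have "worst_cost N (While b c) \<le> (1 + bcost b + K) * Suc N ^ depth (While b c)" for N
  proof -
    have "(1 + bcost b) * 1 \<le> (1 + bcost b) * Suc N ^ depth c"
      by (intro mult_le_mono2) (simp add: Suc_leI)
    then have "1 + bcost b + worst_cost N c \<le> (1 + bcost b + K) * Suc N ^ depth c"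
      using K[of N] by (simp add: add_mult_distrib)
    then have "Suc N * (1 + bcost b + worst_cost N c) \<le>
      Suc N * ((1 + bcost b + K) * Suc N ^ depth c)" by (rule mult_le_mono2)
    then show ?thesis by (simp add: mult.left_commute del: mult_Suc)
  qed
  then show ?case by blast
qed auto

fun regs :: "com \<Rightarrow> string set" where
  "regs (Assign x e) = {x}"
| "regs (Seq c d) = regs c \<union> regs d"
| "regs (Ite b c d) = regs c \<union> regs d"
| "regs (While b c) = regs c"
| "regs _ = {}"

fun arrays :: "com \<Rightarrow> string set" where
  "arrays (Write y e f) = {y}"
| "arrays (Seq c d) = arrays c \<union> arrays d"
| "arrays (Ite b c d) = arrays c \<union> arrays d"
| "arrays (While b c) = arrays c"
| "arrays _ = {}"

text \<open>The frame condition, read off the program text. It keeps loop invariants down to what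
  the loop changes.\<close>

definition same :: "com \<Rightarrow> state \<Rightarrow> state \<Rightarrow> bool" where
  "same c s s' \<longleftrightarrow>
     (\<forall>x. x \<notin> regs c \<longrightarrow> fst s' x = fst s x) \<and> (\<forall>y. y \<notin> arrays c \<longrightarrow> snd s' y = snd s y)"

lemma sameD:
  assumes "same c s s'"
  shows "x \<notin> regs c \<Longrightarrow> fst s' x = fst s x" "y \<notin> arrays c \<Longrightarrow> snd s' y = snd s y"
  using assms by (auto simp: same_def)

lemma same_refl: "same c s s"
  by (simp add: same_def)

lemma same_trans:
  "same c s s' \<Longrightarrow> same c s' s'' \<Longrightarrow> same c s s''"
  by (simp add: same_def)

lemma exec_same: "exec c s t s' \<Longrightarrow> same c s s'"
  by (induction rule: exec.induct) (auto simp: same_def)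

text \<open>The time bound depends on the program and \<open>N\<close> alone, so a correctness proof
  only has to bound the iterations of each loop.\<close>

definition WP :: "nat \<Rightarrow> com \<Rightarrow> (state \<Rightarrow> bool) \<Rightarrow> state \<Rightarrow> bool" where
  "WP N c Q s \<longleftrightarrow> (\<exists>t s'. exec c s t s' \<and> t \<le> worst_cost N c \<and> Q s')"

lemma WP_Skip: "Q s \<Longrightarrow> WP N Skip Q s"
  unfolding WP_def by (intro exI conjI) (auto intro: exec.Skip)

lemma WP_Assign: "Q ((fst s)(x := aval e s), snd s) \<Longrightarrow> WP N (Assign x e) Q s"
  unfolding WP_def using exec.Assign[of x e "fst s" "snd s"]
  by (metis prod.collapse worst_cost.simps(2) order_refl)

lemma WP_Write:
  "Q (fst s, (snd s)(y := (snd s y)(aval e s := aval f s))) \<Longrightarrow> WP N (Write y e f) Q s"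
  unfolding WP_def using exec.Write[of y e f "fst s" "snd s"]
  by (metis prod.collapse worst_cost.simps(3) order_refl)

lemma WP_Seq: "WP N c (WP N d Q) s \<Longrightarrow> WP N (Seq c d) Q s"
  unfolding WP_def by (metis exec.Seq worst_cost.simps(4) add_mono)

lemma WP_Ite:
  assumes "bval b s \<Longrightarrow> WP N c Q s" "\<not> bval b s \<Longrightarrow> WP N d Q s"
  shows "WP N (Ite b c d) Q s"
proof (cases "bval b s")
  case True
  then obtain t s' where "exec c s t s'" "t \<le> worst_cost N c" "Q s'"
    using assms(1) unfolding WP_def by blast
  then show ?thesis using True unfolding WP_def
    by (intro exI[of _ "1 + bcost b + t"] exI[of _ s']) (simp add: exec.IfTrue[simplified])
next
  case False
  then obtain t s' where "exec d s t s'" "t \<le> worst_cost N d" "Q s'"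
    using assms(2) unfolding WP_def by blast
  then show ?thesis using False unfolding WP_def
    by (intro exI[of _ "1 + bcost b + t"] exI[of _ s']) (simp add: exec.IfFalse[simplified])
qed

lemmas WP_intros = WP_Skip WP_Assign WP_Write WP_Seq WP_Ite

lemma WP_strengthen:
  assumes "WP N c P s" "\<And>s'. P s' \<Longrightarrow> same c s s' \<Longrightarrow> Q s'"
  shows "WP N c Q s"
  using assms exec_same unfolding WP_def by meson

text \<open>The invariant is indexed by the iteration, and the number \<open>k\<close> of iterations
  is fixed beforehand; this gives termination and the time bound at once.\<close>

lemma WP_While:
  assumes "k \<le> N" "I 0 s"
    and body: "\<And>i s'. i < k \<Longrightarrow> I i s' \<Longrightarrow> same c s s' \<Longrightarrow> bval b s' \<and> WP N c (I (Suc i)) s'"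
    and exit: "\<And>s'. I k s' \<Longrightarrow> same c s s' \<Longrightarrow> \<not> bval b s' \<and> Q s'"
  shows "WP N (While b c) Q s"
proof -
  define C where "C = 1 + bcost b + worst_cost N c"
  have "\<exists>t s''. exec (While b c) s' t s'' \<and> t \<le> Suc j * C \<and> Q s''"
    if "j \<le> k" "I (k - j) s'" "same c s s'" for j s'
    using that
  proof (induction j arbitrary: s')
    case 0
    then show ?case using exit[of s'] exec.WhileFalse[of b s' c]
      by (intro exI[of _ "1 + bcost b"] exI[of _ s']) (simp add: C_def)
  next
    case (Suc j)
    then have "bval b s'" "WP N c (I (Suc (k - Suc j))) s'"
      using body[of "k - Suc j" s'] by auto
    then obtain t u where u: "exec c s' t u" "t \<le> worst_cost N c" "I (k - j) u"
      unfolding WP_def using Suc.prems(1) by (metis Suc_diff_Suc Suc_le_lessD)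
    then obtain t' s'' where s'': "exec (While b c) u t' s''" "t' \<le> Suc j * C" "Q s''"
      using Suc.IH[of u] Suc.prems exec_same[OF u(1)] same_trans by (metis Suc_leD)
    have "exec (While b c) s' (1 + bcost b + t + t') s''"
      by (rule exec.WhileTrue[OF \<open>bval b s'\<close> u(1) s''(1)])
    then show ?case using u s'' by (intro exI[of _ "1 + bcost b + t + t'"] exI[of _ s''])
        (simp add: C_def)
  qed
  from this[of k s] obtain t s'' where "exec (While b c) s t s''" "t \<le> Suc k * C" "Q s''"
    using assms(2) same_refl by auto
  moreover have "Suc k * C \<le> worst_cost N (While b c)"
    unfolding worst_cost.simps C_def[symmetric] using assms(1) by (intro mult_le_mono1) simp
  ultimately show ?thesis unfolding WP_def by (metis order_trans)
qed

definition For :: "string \<Rightarrow> string \<Rightarrow> com \<Rightarrow> com" where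
  "For x y c = Seq (Assign x (Lit 0))
     (While (Less (Var x) (Var y)) (Seq c (Assign x (Plus (Var x) (Lit 1)))))"

lemma regs_For [simp]: "regs (For x y c) = insert x (regs c)"
  and arrays_For [simp]: "arrays (For x y c) = arrays c"
  and depth_For [simp]: "depth (For x y c) = Suc (depth c)"
  by (auto simp: For_def)

text \<open>The increment of \<open>x\<close> is built into the rule: the body must establish the
  invariant for the state in which \<open>x\<close> already has its next value.\<close>

lemma WP_For:
  assumes k: "fst s y = k" "k \<le> N" and fresh: "y \<noteq> x" "y \<notin> regs c" "x \<notin> regs c"
    and init: "I 0 ((fst s)(x := 0), snd s)"
    and body: "\<And>i s'. i < k \<Longrightarrow> I i s' \<Longrightarrow> fst s' x = i \<Longrightarrow> same (For x y c) s s' \<Longrightarrow>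
      WP N c (\<lambda>s''. I (Suc i) ((fst s'')(x := Suc i), snd s'')) s'"
    and exit: "\<And>s'. I k s' \<Longrightarrow> fst s' x = k \<Longrightarrow> same (For x y c) s s' \<Longrightarrow> Q s'"
  shows "WP N (For x y c) Q s"
proof -
  define c' where "c' = Seq c (Assign x (Plus (Var x) (Lit 1)))"
  define u where "u = ((fst s)(x := 0), snd s)"
  have same: "same (For x y c) s s'" if "same c' u s'" for s'
    using that unfolding same_def c'_def u_def by auto
  have y: "fst s' y = k" if "same c' u s'" for s'
    using that k fresh unfolding same_def c'_def u_def by auto
  have "WP N (While (Less (Var x) (Var y)) c') Q u"
  proof (rule WP_While[where k = k and I = "\<lambda>i s'. I i s' \<and> fst s' x = i"])
    fix i s' assume i: "i < k" "I i s' \<and> fst s' x = i" "same c' u s'"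
    have "WP N c (\<lambda>s''. I (Suc i) ((fst s'')(x := Suc i), snd s'') \<and> fst s'' x = i) s'"
      by (rule WP_strengthen[OF body]) (use i same sameD fresh in auto)
    then have "WP N c' (\<lambda>s'. I (Suc i) s' \<and> fst s' x = Suc i) s'"
      unfolding c'_def by (intro WP_Seq) (erule WP_strengthen, rule WP_Assign, simp)
    then show "bval (Less (Var x) (Var y)) s' \<and> WP N c' (\<lambda>s'. I (Suc i) s' \<and> fst s' x = Suc i) s'"
      using i y by simp
  next
    fix s' assume "I k s' \<and> fst s' x = k" "same c' u s'"
    then show "\<not> bval (Less (Var x) (Var y)) s' \<and> Q s'"
      using y same exit by simp
  qed (use k init in \<open>auto simp: u_def\<close>)
  then show ?thesis unfolding For_def c'_def[symmetric]
    by (intro WP_Seq WP_Assign) (simp add: u_def)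
qed


section \<open>The program\<close>

abbreviation Then (infixr ";;" 60) where "c ;; d \<equiv> Seq c d"

abbreviation incr :: "string \<Rightarrow> aexp \<Rightarrow> com" where "incr x e \<equiv> Assign x (Plus (Var x) e)"

text \<open>\<open>mul\<close> replaces multiplication by the row length \<open>n + 1\<close>;
  \<open>one\<close> and \<open>zero\<close> are the transitions of the automaton. The row of the
  sink \<open>n\<close> is added after the loop.\<close>

definition tables :: com where
  "tables =
     Assign ''M'' (Plus (Var ''n'') (Lit 1)) ;;
     Assign ''p'' (Lit 0) ;;
     For ''a'' ''n'' (
       Write ''mul'' (Var ''a'') (Var ''p'') ;;
       incr ''p'' (Var ''M'') ;;
       Ite (Equal (Read ''w'' (Var ''a'')) (Lit 0))
         (Write ''one'' (Var ''a'') (Lit 0) ;;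
          Write ''zero'' (Var ''a'') (Plus (Var ''a'') (Lit 1)))
         (Write ''one'' (Var ''a'') (Plus (Var ''a'') (Lit 1)) ;;
          Write ''zero'' (Var ''a'') (Var ''n''))) ;;
     Write ''mul'' (Var ''n'') (Var ''p'') ;;
     Write ''one'' (Var ''n'') (Var ''n'') ;;
     Write ''zero'' (Var ''n'') (Var ''n'')"

lemma WP_tables:
  assumes n: "fst s ''n'' = n" "n < N" and w: "\<forall>j<n. snd s ''w'' j = of_bool (W j)"
  shows "WP N tables (\<lambda>s'. fst s' ''M'' = Suc n \<and> (\<forall>j\<le>n. snd s' ''mul'' j = j * Suc n \<and>
    snd s' ''one'' j = step W n j True \<and> snd s' ''zero'' j = step W n j False)) s"
  unfolding tables_def
proof (intro WP_intros, rule WP_For[where k = n and I = "\<lambda>i s'. fst s' ''p'' = i * Suc n \<and>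
    (\<forall>j<i. snd s' ''mul'' j = j * Suc n \<and>
      snd s' ''one'' j = step W n j True \<and> snd s' ''zero'' j = step W n j False)"], goal_cases)
  case (7 i s')
  note [simp] = sameD[OF 7(4)]
  show ?case
    by (intro WP_intros) (use 7 w in \<open>auto simp: n less_Suc_eq step_def\<close>)
next
  case (8 s')
  note [simp] = sameD[OF 8(3)]
  show ?case
    by (intro WP_intros) (use 8 in \<open>auto simp: n le_less step_def\<close>)
qed (use n in auto)

section \<open>The dynamic program over pairs of states\<close>

definition grid :: "com \<Rightarrow> com" where
  "grid c = For ''a'' ''M'' (For ''b'' ''M'' (c ;; incr ''p'' (Lit 1)))"

lemma regs_grid [simp]: "regs (grid c) = {''a'', ''b'', ''p''} \<union> regs c"
  and arrays_grid [simp]: "arrays (grid c) = arrays c"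
  and depth_grid [simp]: "depth (grid c) = Suc (Suc (depth c))"
  by (auto simp: grid_def)

text \<open>The register \<open>p\<close> advances with the row-major traversal, so the write index
  is never computed. The invariant extends the correct prefix of \<open>g\<close> by one entry at a
  time.\<close>

lemma WP_grid:
  assumes M: "fst s ''M'' = M" "M \<le> N" and c: "regs c = {}" "arrays c = {''g''}"
    and p: "fst s ''p'' = p" and g: "\<forall>k<p. snd s ''g'' k = val k"
    and body: "\<And>a b s'. a < M \<Longrightarrow> b < M \<Longrightarrow> same (grid c) s s' \<Longrightarrow>
      fst s' ''a'' = a \<Longrightarrow> fst s' ''b'' = b \<Longrightarrow> fst s' ''p'' = p + a * M + b \<Longrightarrow>
      \<forall>k < p + a * M + b. snd s' ''g'' k = val k \<Longrightarrow>
      WP N c (\<lambda>s'. \<forall>k < Suc (p + a * M + b). snd s' ''g'' k = val k) s'"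
  shows "WP N (grid c) (\<lambda>s'. fst s' ''p'' = p + M * M \<and> (\<forall>k < p + M * M. snd s' ''g'' k = val k)) s"
  unfolding grid_def
proof (rule WP_For[where k = M and I = "\<lambda>a s'. fst s' ''p'' = p + a * M \<and>
    (\<forall>k < p + a * M. snd s' ''g'' k = val k)"], goal_cases)
  case (7 a s1)
  note [simp] = sameD[OF 7(4)]
  show ?case
  proof (rule WP_For[where k = M and I = "\<lambda>b s'. fst s' ''p'' = p + a * M + b \<and>
      (\<forall>k < p + a * M + b. snd s' ''g'' k = val k)"], goal_cases)
    case (7 b s2)
    note [simp] = sameD[OF 7(4)]
    have same: "same (grid c) s s2"
      unfolding same_def using c by (auto simp: M)
    have wp: "WP N c (\<lambda>s'. \<forall>k < Suc (p + a * M + b). snd s' ''g'' k = val k) s2"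
      by (rule body[OF _ _ same]) (use 7 \<open>a < M\<close> \<open>fst s1 ''a'' = a\<close> c in auto)
    show ?case
    proof (rule WP_Seq, rule WP_strengthen[OF wp], goal_cases)
      case (1 s3)
      note [simp] = sameD[OF 1(2)]
      show ?case by (intro WP_intros) (use 1 7 c in auto)
    qed
  next
    case (8 s2)
    then show ?case by (simp add: add.assoc add.commute[of M])
  qed (use 7 M c in auto)
next
  case (8 s')
  then show ?case by simp
qed (use M p g c in auto)

definition fill :: com where
  "fill =
     Assign ''p'' (Lit 0) ;;
     grid (Ite (Conj (Equal (Var ''a'') (Var ''r'')) (Equal (Var ''b'') (Var ''q'')))
       (Write ''g'' (Var ''p'') (Lit 1)) (Write ''g'' (Var ''p'') (Lit 0)))"

text \<open>One use of the recurrence \<open>pair_count_Suc\<close>: \<open>B\<close> is the start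
  of the previous layer, and \<open>p\<close> continues where that layer ended.\<close>

definition layer :: com where
  "layer = grid (Write ''g'' (Var ''p'')
     (Plus (Read ''g'' (Plus (Var ''B'')
              (Plus (Read ''mul'' (Read ''one'' (Var ''a''))) (Read ''zero'' (Var ''b'')))))
           (Read ''g'' (Plus (Var ''B'')
              (Plus (Read ''mul'' (Read ''zero'' (Var ''a''))) (Read ''one'' (Var ''b'')))))))"

text \<open>The array \<open>g\<close> holds \<open>pair_count W n q r i a b\<close> at index \<open>(i * M + a) * M + b\<close>, \<open>M = n + 1\<close>.\<close>

definition cell :: "(nat \<Rightarrow> bool) \<Rightarrow> nat \<Rightarrow> nat \<Rightarrow> nat \<Rightarrow> nat \<Rightarrow> nat" where
  "cell W n q r k = pair_count W n q r (k div Suc n div Suc n) (k div Suc n mod Suc n) (k mod Suc n)"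

lemma cell_eq:
  assumes "a \<le> n" "b \<le> n"
  shows "cell W n q r (i * (Suc n * Suc n) + a * Suc n + b) = pair_count W n q r i a b"
proof -
  define k where "k = i * (Suc n * Suc n) + a * Suc n + b"
  have k: "k = b + (a + i * Suc n) * Suc n" unfolding k_def by (simp add: algebra_simps)
  have "k div Suc n = a + i * Suc n" "k mod Suc n = b"
    unfolding k using assms(2) by (simp_all only: div_mult_self1 mod_mult_self1) simp_all
  moreover have "(a + i * Suc n) div Suc n = i" "(a + i * Suc n) mod Suc n = a"
    using assms(1) by (simp_all only: div_mult_self1 mod_mult_self1) simp_all
  ultimately show ?thesis unfolding k_def[symmetric] cell_def by simp
qed

definition states_ok :: "(nat \<Rightarrow> bool) \<Rightarrow> nat \<Rightarrow> state \<Rightarrow> bool" where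
  "states_ok W n s \<longleftrightarrow> fst s ''n'' = n \<and> fst s ''M'' = Suc n \<and>
     (\<forall>j\<le>n. snd s ''mul'' j = j * Suc n \<and>
       snd s ''one'' j = step W n j True \<and> snd s ''zero'' j = step W n j False)"

lemma WP_fill:
  assumes "states_ok W n s" "n < N" "fst s ''q'' = q" "fst s ''r'' = r"
  shows "WP N fill (\<lambda>s'. fst s' ''p'' = Suc n * Suc n \<and>
    (\<forall>k < Suc n * Suc n. snd s' ''g'' k = cell W n q r k)) s"
  unfolding fill_def
proof (intro WP_Seq WP_Assign,
    rule WP_strengthen[OF WP_grid[where M = "Suc n" and p = 0 and val = "cell W n q r"]], goal_cases)
  case (7 a b s')
  note [simp] = sameD[OF 7(3)]
  have "cell W n q r (0 * (Suc n * Suc n) + a * Suc n + b) = of_bool (a = r \<and> b = q)"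
    by (subst cell_eq) (use 7 in \<open>auto simp: pair_count_0\<close>)
  then have "cell W n q r (a * Suc n + b) = of_bool (a = r \<and> b = q)" by simp
  then show ?case
    by (intro WP_intros) (use 7 assms in \<open>auto simp: less_Suc_eq simp del: mult_Suc_right\<close>)
qed (use assms in \<open>auto simp: states_ok_def\<close>)

lemma WP_layer:
  assumes s: "states_ok W n s" "n < N" and B: "fst s ''B'' = i * (Suc n * Suc n)"
    and p: "fst s ''p'' = Suc i * (Suc n * Suc n)"
    and g: "\<forall>k < Suc i * (Suc n * Suc n). snd s ''g'' k = cell W n q r k"
  shows "WP N layer (\<lambda>s'. fst s' ''p'' = Suc (Suc i) * (Suc n * Suc n) \<and>
    (\<forall>k < Suc (Suc i) * (Suc n * Suc n). snd s' ''g'' k = cell W n q r k)) s"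
  unfolding layer_def
proof (rule WP_strengthen[OF WP_grid[where M = "Suc n" and p = "Suc i * (Suc n * Suc n)"
        and val = "cell W n q r"]], goal_cases)
  case (7 a b s')
  define P where "P = Suc i * (Suc n * Suc n) + a * Suc n + b"
  note [simp] = sameD[OF 7(3)]
  have ab: "a \<le> n" "b \<le> n" using 7 by auto
  \<comment> \<open>All entries read belong to layer \<open>i\<close>, which lies before the entry
    \<open>P\<close> being written.\<close>
  have rd: "snd s' ''g'' (i * (Suc n * Suc n) + (a' * Suc n + b')) = pair_count W n q r i a' b'"
    if "a' \<le> n" "b' \<le> n" for a' b'
  proof -
    have "a' * Suc n + b' < Suc n * Suc n"
    proof -
      have "a' * Suc n \<le> n * Suc n" using that by (intro mult_le_mono1)
      then show ?thesis using that by simp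
    qed
    then have "i * (Suc n * Suc n) + (a' * Suc n + b') < P" unfolding P_def by simp
    then show ?thesis using 7(7) cell_eq[OF that] unfolding P_def by (simp only: add.assoc)
  qed
  have "cell W n q r P = pair_count W n q r (Suc i) a b"
    unfolding P_def by (rule cell_eq[OF ab])
  also have "\<dots> = pair_count W n q r i (step W n a True) (step W n b False) +
     pair_count W n q r i (step W n a False) (step W n b True)" by (rule pair_count_Suc)
  finally have cl: "cell W n q r P = \<dots>" .
  have tab: "snd s ''mul'' j = j * Suc n" "snd s ''one'' j = step W n j True"
    "snd s ''zero'' j = step W n j False" if "j \<le> n" for j
    using s that by (simp_all add: states_ok_def)
  have sB: "fst s' ''B'' = i * (Suc n * Suc n)" using B by simp
  show ?case
    unfolding P_def[symmetric]
    by (intro WP_intros)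
      (use 7(4-7) in \<open>simp add: P_def[symmetric] sB tab ab step_le rd cl less_Suc_eq
        del: mult_Suc mult_Suc_right\<close>)
next
  case (8 s')
  then show ?case by (simp add: algebra_simps)
qed (use s p g in \<open>auto simp: states_ok_def\<close>)


lemma states_ok_same:
  assumes "states_ok W n s" "same c s s'" "regs c \<inter> {''n'', ''M''} = {}"
    "arrays c \<inter> {''mul'', ''one'', ''zero''} = {}"
  shows "states_ok W n s'"
  using assms by (auto simp: states_ok_def same_def)

lemma regs_fill [simp]: "regs fill = {''p'', ''a'', ''b''}"
  and arrays_fill [simp]: "arrays fill = {''g''}"
  and depth_fill [simp]: "depth fill = 2"
  by (auto simp: fill_def)

lemma regs_layer [simp]: "regs layer = {''p'', ''a'', ''b''}"
  and arrays_layer [simp]: "arrays layer = {''g''}"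
  and depth_layer [simp]: "depth layer = 2"
  by (auto simp: layer_def)

text \<open>The entry of layer \<open>i\<close> at the states \<open>(q, r)\<close> counts the words
  of length \<open>i\<close> whose run closes up; it is collected before the next layer is built, so
  one pass serves all lengths.\<close>

definition count :: com where
  "count = For ''i'' ''n'' (
     Write ''A'' (Var ''i'') (Plus (Read ''A'' (Var ''i''))
       (Read ''g'' (Plus (Var ''B'') (Plus (Read ''mul'' (Var ''q'')) (Var ''r''))))) ;;
     layer ;;
     incr ''B'' (Var ''L''))"

lemma WP_count:
  assumes s: "states_ok W n s" "n < N" and qr: "fst s ''q'' = q" "fst s ''r'' = r" "q < n" "r < n"
    and L: "fst s ''L'' = Suc n * Suc n" and B: "fst s ''B'' = 0"
    and p: "fst s ''p'' = Suc n * Suc n"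
    and g: "\<forall>k < Suc n * Suc n. snd s ''g'' k = cell W n q r k"
  shows "WP N count (\<lambda>s'. \<forall>d. snd s' ''A'' d =
    snd s ''A'' d + (if d < n then pair_count W n q r d q r else 0)) s"
  unfolding count_def
proof (rule WP_For[where k = n and I = "\<lambda>i s'. fst s' ''B'' = i * (Suc n * Suc n) \<and>
    fst s' ''p'' = Suc i * (Suc n * Suc n) \<and>
    (\<forall>k < Suc i * (Suc n * Suc n). snd s' ''g'' k = cell W n q r k) \<and>
    (\<forall>d. snd s' ''A'' d = snd s ''A'' d + (if d < i then pair_count W n q r d q r else 0))"],
    goal_cases)
  case (7 i s')
  note I = 7(2)
  have ok: "states_ok W n s'" by (rule states_ok_same[OF s(1) 7(4)]) auto
  note [simp] = sameD[OF 7(4)]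
  define u where "u = (fst s', (snd s')(''A'' := (snd s' ''A'')(i := snd s' ''A'' i +
      snd s' ''g'' (i * (Suc n * Suc n) + (q * Suc n + r)))))"
  have "snd s' ''g'' (i * (Suc n * Suc n) + (q * Suc n + r)) = pair_count W n q r i q r"
  proof -
    have "q * Suc n \<le> n * Suc n" using qr by (intro mult_le_mono1) simp
    then have "q * Suc n + r < Suc n * Suc n" using qr by simp
    then have "i * (Suc n * Suc n) + (q * Suc n + r) < Suc i * (Suc n * Suc n)" by simp
    then show ?thesis using I cell_eq[of q n r W q r i] qr by (simp only: add.assoc)
  qed
  then have u: "snd u ''A'' d = snd s ''A'' d + (if d < Suc i then pair_count W n q r d q r else 0)"
    for d using I by (simp add: u_def less_Suc_eq)
  have oku: "states_ok W n u" using ok by (simp add: states_ok_def u_def)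
  have wp: "WP N layer (\<lambda>s'. fst s' ''p'' = Suc (Suc i) * (Suc n * Suc n) \<and>
    (\<forall>k < Suc (Suc i) * (Suc n * Suc n). snd s' ''g'' k = cell W n q r k)) u"
    by (rule WP_layer[OF oku s(2), of i]) (use I in \<open>auto simp: u_def\<close>)
  have e: "aval (Plus (Read ''A'' (Var ''i'')) (Read ''g'' (Plus (Var ''B'')
    (Plus (Read ''mul'' (Var ''q'')) (Var ''r''))))) s' = snd s' ''A'' i +
      snd s' ''g'' (i * (Suc n * Suc n) + (q * Suc n + r))" "aval (Var ''i'') s' = i"
    using I 7(3) qr ok by (simp_all add: states_ok_def del: mult_Suc mult_Suc_right)
  show ?case
  proof (rule WP_Seq, rule WP_Write, unfold e u_def[symmetric], rule WP_Seq,
      rule WP_strengthen[OF wp], goal_cases)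
    case (1 s3)
    note [simp] = sameD[OF 1(2)]
    have "fst u ''B'' = i * (Suc n * Suc n)" "fst u ''L'' = Suc n * Suc n"
      using I L by (simp_all add: u_def)
    then show ?case by (intro WP_Assign) (use 1(1) u in simp)
  qed
next
  case (8 s')
  then show ?case by simp
qed (use s p g B in \<open>auto simp: states_ok_def\<close>)

lemma regs_count [simp]: "regs count = {''i'', ''p'', ''a'', ''b'', ''B''}"
  and arrays_count [simp]: "arrays count = {''A'', ''g''}"
  and depth_count [simp]: "depth count = 3"
  by (auto simp: count_def)

text \<open>After \<open>fill\<close>, \<open>p\<close> equals the size of a layer and thus supplies
  \<open>L\<close> without a multiplication.\<close>

definition states :: com where
  "states = For ''q'' ''n'' (For ''r'' ''n'' (
     fill ;;
     Assign ''L'' (Var ''p'') ;;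
     Assign ''B'' (Lit 0) ;;
     count))"

lemma WP_states:
  assumes s: "states_ok W n s" "n < N"
  shows "WP N states (\<lambda>s'. \<forall>d. snd s' ''A'' d =
    snd s ''A'' d + (if d < n then \<Sum>q<n. \<Sum>r<n. pair_count W n q r d q r else 0)) s"
  unfolding states_def
proof (rule WP_For[where k = n and I = "\<lambda>q s'. \<forall>d. snd s' ''A'' d =
    snd s ''A'' d + (if d < n then \<Sum>q<q. \<Sum>r<n. pair_count W n q r d q r else 0)"], goal_cases)
  case (7 q s1)
  have ok1: "states_ok W n s1" by (rule states_ok_same[OF s(1) 7(4)]) auto
  note 1 = 7
  show ?case
  proof (rule WP_For[where k = n and I = "\<lambda>r s'. \<forall>d. snd s' ''A'' d =
      snd s1 ''A'' d + (if d < n then \<Sum>r<r. pair_count W n q r d q r else 0)"], goal_cases)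
    case (7 r s2)
    have ok2: "states_ok W n s2" by (rule states_ok_same[OF ok1 7(4)]) auto
    have qr: "fst s2 ''q'' = q" "fst s2 ''r'' = r" using 7 1 sameD[OF 7(4)] by auto
    show ?case
    proof (rule WP_Seq, rule WP_strengthen[OF WP_fill[OF ok2 s(2) qr]],
        intro WP_Seq WP_Assign, goal_cases)
      case (1 s3)
      have ok3: "states_ok W n s3" by (rule states_ok_same[OF ok2 1(2)]) auto
      note [simp] = sameD[OF 1(2)]
      show ?case
        by (rule WP_strengthen[OF WP_count[where W = W and n = n and q = q and r = r]])
          (use ok3 s(2) qr 1(1) 7 \<open>q < n\<close> in \<open>simp_all add: states_ok_def\<close>)
    qed
  next
    case (8 s2)
    then show ?case using 1(2) by simp
  qed (use 7 ok1 s in \<open>auto simp: states_ok_def\<close>)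
next
  case (8 s')
  then show ?case by simp
qed (use s in \<open>auto simp: states_ok_def\<close>)

lemma regs_states [simp]: "regs states = {''q'', ''r'', ''L'', ''i'', ''p'', ''a'', ''b'', ''B''}"
  and arrays_states [simp]: "arrays states = {''A'', ''g''}"
  and depth_states [simp]: "depth states = 5"
  by (auto simp: states_def)


section \<open>Complementary counts and the sieve\<close>

definition differences :: com where
  "differences =
     Assign ''P'' (Lit 1) ;;
     For ''i'' ''n'' (
       Write ''D'' (Var ''i'') (Minus (Var ''P'') (Read ''A'' (Var ''i''))) ;;
       incr ''P'' (Var ''P''))"

lemma WP_differences:
  assumes n: "fst s ''n'' = n" "n < N"
  shows "WP N differences (\<lambda>s'. \<forall>d<n. snd s' ''D'' d = 2 ^ d - snd s ''A'' d) s"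
  unfolding differences_def
proof (intro WP_Seq WP_Assign, rule WP_For[where k = n and I = "\<lambda>i s'. fst s' ''P'' = 2 ^ i \<and>
    (\<forall>d<i. snd s' ''D'' d = 2 ^ d - snd s ''A'' d)"], goal_cases)
  case (7 i s')
  note [simp] = sameD[OF 7(4)]
  show ?case by (intro WP_intros) (use 7 in \<open>auto simp: less_Suc_eq\<close>)
qed (use n in auto)

text \<open>With \<open>K\<close> equal to \<open>2 * e\<close>, \<open>f\<close> runs through the
  odd multiples of \<open>e\<close> from \<open>3 * e\<close> on, so the subtrahend at
  \<open>e\<close> stays fixed.\<close>

definition sieve :: com where
  "sieve =
     Assign ''f'' (Plus (Var ''e'') (Var ''K'')) ;;
     While (Less (Var ''f'') (Var ''n'')) (
       Write ''D'' (Var ''f'') (Minus (Read ''D'' (Var ''f'')) (Read ''D'' (Var ''e''))) ;;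
       incr ''f'' (Var ''K''))"

lemma WP_sieve:
  assumes n: "fst s ''n'' = n" "n < N" and e: "fst s ''e'' = e" "0 < e" "fst s ''K'' = 2 * e"
  shows "WP N sieve (\<lambda>s'. \<forall>x<n. snd s' ''D'' x =
    (if \<exists>q\<ge>1. x = (2 * q + 1) * e then snd s ''D'' x - snd s ''D'' e else snd s ''D'' x)) s"
proof -
  \<comment> \<open>The number of odd multiples of \<open>e\<close>, from \<open>3 * e\<close> on,
    that are below \<open>n\<close>.\<close>
  define k where "k = (LEAST i. \<not> (2 * i + 3) * e < n)"
  have "\<not> (2 * n + 3) * e < n" using e(2) by (cases e) auto
  then have k: "k \<le> n" "\<not> (2 * k + 3) * e < n"
    unfolding k_def by (rule Least_le, rule LeastI)
  have lt: "(2 * i + 3) * e < n" if "i < k" for i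
    using not_less_Least[of i "\<lambda>i. \<not> (2 * i + 3) * e < n"] that unfolding k_def by blast
  have not_mult: "\<not> (\<exists>q\<ge>1. e = (2 * q + 1) * e)" using e(2) by auto
  show ?thesis
    unfolding sieve_def
  proof (intro WP_Seq WP_Assign, rule WP_While[where k = k and
      I = "\<lambda>i s'. fst s' ''f'' = (2 * i + 3) * e \<and> (\<forall>x. snd s' ''D'' x =
        (if \<exists>q\<ge>1. q \<le> i \<and> x = (2 * q + 1) * e then snd s ''D'' x - snd s ''D'' e
         else snd s ''D'' x))"], goal_cases)
    case 1
    then show ?case using k n by simp
  next
    case 2
    then show ?case using e by simp
  next
    case (3 i s')
    note [simp] = sameD[OF 3(3)]
    define x where "x = (2 * i + 3) * e"
    have f: "fst s' ''f'' = x" "fst s' ''e'' = e" "fst s' ''K'' = 2 * e" "fst s' ''n'' = n"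
      using 3(2) e n by (simp_all add: x_def)
    have D: "snd s' ''D'' y = (if \<exists>q\<ge>1. q \<le> i \<and> y = (2 * q + 1) * e
        then snd s ''D'' y - snd s ''D'' e else snd s ''D'' y)" for y
      using 3(2) by blast
    have De: "snd s' ''D'' e = snd s ''D'' e" unfolding D using not_mult by auto
    have nx: "\<not> (\<exists>q\<ge>1. q \<le> i \<and> x = (2 * q + 1) * e)"
    proof
      assume "\<exists>q\<ge>1. q \<le> i \<and> x = (2 * q + 1) * e"
      then obtain q where "q \<le> i" "(2 * i + 3) * e = (2 * q + 1) * e" unfolding x_def by blast
      then show False using e(2) by (simp only: mult_cancel2) simp
    qed
    have Dx: "snd s' ''D'' x = snd s ''D'' x" unfolding D by (rule if_not_P[OF nx])
    have iff: "(\<exists>q\<ge>1. q \<le> Suc i \<and> y = (2 * q + 1) * e) \<longleftrightarrow>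
      (\<exists>q\<ge>1. q \<le> i \<and> y = (2 * q + 1) * e) \<or> y = x" for y
    proof -
      have "2 * i + 3 = 2 * Suc i + 1" by simp
      then have x: "x = (2 * Suc i + 1) * e" by (simp only: x_def)
      show ?thesis
      proof
        assume "\<exists>q\<ge>1. q \<le> Suc i \<and> y = (2 * q + 1) * e"
        then obtain q where q: "1 \<le> q" "q \<le> Suc i" "y = (2 * q + 1) * e" by blast
        show "(\<exists>q\<ge>1. q \<le> i \<and> y = (2 * q + 1) * e) \<or> y = x"
        proof (cases "q \<le> i")
          case True
          then show ?thesis using q by blast
        next
          case False
          then have "q = Suc i" using q(2) by simp
          then show ?thesis using q(3) x by simp
        qed
      next
        assume "(\<exists>q\<ge>1. q \<le> i \<and> y = (2 * q + 1) * e) \<or> y = x"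
        then show "\<exists>q\<ge>1. q \<le> Suc i \<and> y = (2 * q + 1) * e"
        proof
          assume "\<exists>q\<ge>1. q \<le> i \<and> y = (2 * q + 1) * e"
          then show ?thesis using le_SucI by blast
        next
          assume "y = x"
          then show ?thesis unfolding x by (intro exI[of _ "Suc i"]) simp
        qed
      qed
    qed
    have "x < n" using lt[OF 3(1)] by (simp add: x_def)
    moreover have "x + 2 * e = (2 * Suc i + 3) * e" by (simp add: x_def algebra_simps)
    ultimately show ?case
    proof (intro conjI WP_Seq WP_Write WP_Assign, goal_cases)
      case 1 then show ?case using f by simp
    next
      case 2 then show ?case using f by simp
    next
      case 3
      show ?case unfolding iff using f De Dx D by auto
    qed
  next
    case (4 s')
    note [simp] = sameD[OF 4(2)]
    have iff: "(\<exists>q\<ge>1. q \<le> k \<and> x = (2 * q + 1) * e) \<longleftrightarrow> (\<exists>q\<ge>1. x = (2 * q + 1) * e)"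
      if "x < n" for x
    proof -
      have "q \<le> k" if q: "x = (2 * q + 1) * e" for q
      proof (rule ccontr)
        assume "\<not> q \<le> k"
        then have "(2 * k + 3) * e \<le> (2 * q + 1) * e" by (intro mult_le_mono1) simp
        then show False using k(2) q \<open>x < n\<close> by simp
      qed
      then show ?thesis by blast
    qed
    show ?case using 4(1) k(2) n iff by simp
  qed
qed

section \<open>Divisibility and division by addition and subtraction\<close>

definition multiples :: com where
  "multiples =
     Assign ''R'' (Lit 0) ;;
     While (Less (Var ''R'') (Var ''m'')) (incr ''R'' (Var ''K''))"

text \<open>The first multiple of \<open>K\<close> that is not below \<open>m\<close> equals
  \<open>m\<close> exactly when \<open>K\<close> divides \<open>m\<close>.\<close>

lemma WP_multiples:
  assumes "fst s ''m'' = m" "m < N" "fst s ''K'' = K" "0 < K"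
  shows "WP N multiples (\<lambda>s'. fst s' ''R'' = m \<longleftrightarrow> K dvd m) s"
proof -
  define k where "k = (LEAST i. \<not> i * K < m)"
  have "\<not> m * K < m" using assms(4) by (cases K) auto
  then have k: "k \<le> m" "\<not> k * K < m"
    unfolding k_def by (rule Least_le, rule LeastI)
  have lt: "i * K < m" if "i < k" for i
    using not_less_Least[of i "\<lambda>i. \<not> i * K < m"] that unfolding k_def by blast
  have dvd: "k * K = m \<longleftrightarrow> K dvd m"
  proof
    assume "K dvd m"
    then obtain j where j: "m = j * K" by (metis dvd_def mult.commute)
    have "j \<le> k" using k(2) j assms(4) by simp
    moreover have "k \<le> j" unfolding k_def by (rule Least_le) (simp add: j)
    ultimately show "k * K = m" using j by simp
  qed auto
  show ?thesis unfolding multiples_def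
  proof (intro WP_Seq WP_Assign,
      rule WP_While[where k = k and I = "\<lambda>i s'. fst s' ''R'' = i * K"], goal_cases)
    case (3 i s')
    note [simp] = sameD[OF 3(3)]
    show ?case using 3 lt assms by (auto intro!: WP_Assign)
  next
    case (4 s')
    note [simp] = sameD[OF 4(2)]
    show ?case using 4 k assms dvd by auto
  qed (use k assms in auto)
qed

text \<open>Binary long division: \<open>T\<close> holds the divisor times powers of two,
  \<open>U\<close> the powers themselves. The first loop leaves \<open>i\<close> equal to
  \<open>n\<close>; the second then lowers it to go through the tables from the top.\<close>

definition quotient :: com where
  "quotient =
     Assign ''X'' (Read ''D'' (Var ''e'')) ;;
     Assign ''P'' (Var ''K'') ;;
     Assign ''Q'' (Lit 1) ;;
     For ''i'' ''n'' (
       Write ''T'' (Var ''i'') (Var ''P'') ;;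
       Write ''U'' (Var ''i'') (Var ''Q'') ;;
       incr ''P'' (Var ''P'') ;;
       incr ''Q'' (Var ''Q'')) ;;
     For ''j'' ''n'' (
       Assign ''i'' (Minus (Var ''i'') (Lit 1)) ;;
       Ite (Less (Var ''X'') (Read ''T'' (Var ''i''))) Skip
         (Assign ''X'' (Minus (Var ''X'') (Read ''T'' (Var ''i''))) ;;
          incr ''result'' (Read ''U'' (Var ''i''))))"

lemma WP_quotient:
  assumes n: "fst s ''n'' = n" "n < N" and K: "fst s ''K'' = K" "0 < K"
    and X: "snd s ''D'' (fst s ''e'') = X" "X < K * 2 ^ n"
  shows "WP N quotient (\<lambda>s'. fst s' ''result'' = fst s ''result'' + X div K) s"
  unfolding quotient_def
proof (intro WP_Seq WP_Assign, rule WP_For[where k = n and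
    I = "\<lambda>i s'. fst s' ''P'' = K * 2 ^ i \<and> fst s' ''Q'' = 2 ^ i \<and>
      (\<forall>j<i. snd s' ''T'' j = K * 2 ^ j \<and> snd s' ''U'' j = 2 ^ j)"], goal_cases)
  case (7 i s1)
  note [simp] = sameD[OF 7(4)]
  show ?case by (intro WP_intros) (use 7 in \<open>auto simp: less_Suc_eq\<close>)
next
  case (8 s1)
  note [simp] = sameD[OF 8(3)]
  note I = 8(1,2)
  show ?case
  \<comment> \<open>The remainder stays below \<open>K * 2 ^ (n - j)\<close>, so after
    \<open>n\<close> rounds it is below \<open>K\<close> and the collected \<open>q\<close> is the
    quotient.\<close>
  proof (rule WP_For[where k = n and I = "\<lambda>j s'. fst s' ''i'' = n - j \<and>
      fst s' ''X'' < K * 2 ^ (n - j) \<and>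
      (\<exists>q. X = fst s' ''X'' + K * q \<and> fst s' ''result'' = fst s ''result'' + q)"], goal_cases)
    case (7 j s2)
    note [simp] = sameD[OF 7(4)]
    obtain q where q: "X = fst s2 ''X'' + K * q" "fst s2 ''result'' = fst s ''result'' + q"
      using 7(2) by blast
    define i where "i = n - Suc j"
    have i: "n - j = Suc i" "i < n" using 7(1) by (auto simp: i_def)
    have x: "fst s2 ''X'' < K * 2 ^ Suc i" "fst s2 ''i'' = Suc i" using 7(2) i by auto
    have TU: "snd s1 ''T'' i = K * 2 ^ i" "snd s1 ''U'' i = 2 ^ i" using I i by auto
    show ?case unfolding i_def[symmetric]
    proof (intro WP_intros, goal_cases)
      case 1
      then show ?case using q x TU by simp
    next
      case 2
      then have ge: "K * 2 ^ i \<le> fst s2 ''X''" using x TU by simp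
      then have "X = (fst s2 ''X'' - K * 2 ^ i) + K * (q + 2 ^ i)"
        using q by (simp add: algebra_simps)
      then show ?case using q x TU ge by (auto intro: exI[of _ "q + 2 ^ i"])
    qed
  next
    case (8 s2)
    then obtain q where q: "fst s2 ''X'' < K" "X = fst s2 ''X'' + K * q"
      "fst s2 ''result'' = fst s ''result'' + q" by auto
    then have "X div K = q" using K(2) by simp
    then show ?case using q by simp
  qed (use I n X in auto)
qed (use n K in auto)

text \<open>Sieve and summation share a loop: when \<open>e\<close> is reached, all smaller least
  antiperiods have been sieved out, so for \<open>2 * e \<le> n\<close> the entry of
  \<open>D\<close> at \<open>e\<close> counts the sequences with least antiperiod
  \<open>e\<close>.\<close>

definition necklace_sum :: com where
  "necklace_sum = For ''e'' ''n'' (Ite (Less (Lit 0) (Var ''e''))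
     (Assign ''K'' (Plus (Var ''e'') (Var ''e'')) ;;
      sieve ;;
      multiples ;;
      Ite (Equal (Var ''R'') (Var ''m'')) quotient Skip)
     Skip)"

text \<open>Ensures that \<open>n\<close> binary digits suffice for the quotients.\<close>

lemma card_below_le: "card (below W d E) \<le> 2 ^ d"
proof (cases "d = 0")
  case True
  then have "below W d E = {}" by (auto simp: below_def anti_def)
  then show ?thesis by simp
next
  case False
  have "card (below W d E) \<le> card {y. anti d y}"
    by (rule card_mono[OF finite_anti]) (auto simp: below_def)
  also have "\<dots> = 2 ^ d"
    using bij_betw_same_card[OF bij_betw_anti[of d]] False card_words by simp
  finally show ?thesis .
qed

lemma regs_sieve [simp]: "regs sieve = {''f''}"
  and arrays_sieve [simp]: "arrays sieve = {''D''}"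
  and depth_sieve [simp]: "depth sieve = 1"
  by (auto simp: sieve_def)

lemma regs_multiples [simp]: "regs multiples = {''R''}"
  and arrays_multiples [simp]: "arrays multiples = {}"
  and depth_multiples [simp]: "depth multiples = 1"
  by (auto simp: multiples_def)

lemma regs_quotient [simp]: "regs quotient = {''X'', ''P'', ''Q'', ''i'', ''j'', ''result''}"
  and arrays_quotient [simp]: "arrays quotient = {''T'', ''U''}"
  and depth_quotient [simp]: "depth quotient = 1"
  by (auto simp: quotient_def)

lemma WP_necklace_sum:
  assumes n: "fst s ''n'' = n" "n < N" "0 < n" and m: "fst s ''m'' = m" "0 < m" "m \<le> n"
    and D: "\<And>d. 0 < d \<Longrightarrow> 2 * d \<le> n \<Longrightarrow> snd s ''D'' d = card (below W d 1)"
  shows "WP N necklace_sum (\<lambda>s'. fst s' ''result'' = fst s ''result'' +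
    (\<Sum>e\<in>{1..m}. if 2 * e dvd m then card (below W e e) div (2 * e) else 0)) s"
proof -
  \<comment> \<open>\<open>F\<close> vanishes outside the range from \<open>1\<close> to
    \<open>m - 1\<close>, which reconciles the loop range \<open>e < n\<close> with the sum up to
    \<open>m\<close>.\<close>
  define F where "F e = (if 0 < e \<and> 2 * e dvd m then card (below W e e) div (2 * e) else 0)" for e
  have F: "(\<Sum>e<n. F e) = (\<Sum>e\<in>{1..m}. if 2 * e dvd m then card (below W e e) div (2 * e) else 0)"
  proof -
    have "F e = 0" if "\<not> (1 \<le> e \<and> e < m)" for e
      using that m(2) dvd_imp_le[of "2 * e" m] by (auto simp: F_def)
    then have "(\<Sum>e<n. F e) = (\<Sum>e\<in>{1..<m}. F e)" "(\<Sum>e\<in>{1..m}. F e) = (\<Sum>e\<in>{1..<m}. F e)"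
      using m(3) by (auto intro!: sum.mono_neutral_right)
    moreover have "(\<Sum>e\<in>{1..m}. F e) =
        (\<Sum>e\<in>{1..m}. if 2 * e dvd m then card (below W e e) div (2 * e) else 0)"
      by (rule sum.cong) (auto simp: F_def)
    ultimately show ?thesis by simp
  qed
  \<comment> \<open>The entries from \<open>e\<close> on have reached stage \<open>e\<close> of the
    sieve; \<open>max 1 e\<close> covers the round \<open>e = 0\<close>, which does nothing.\<close>
  define J where "J e s' \<longleftrightarrow> (\<forall>d. 0 < d \<longrightarrow> e \<le> d \<longrightarrow> 2 * d \<le> n \<longrightarrow>
      snd s' ''D'' d = card (below W d (max 1 e)))" for e and s' :: state
  show ?thesis
    unfolding necklace_sum_def F[symmetric]
  proof (rule WP_For[where k = n and I = "\<lambda>e s'. J e s' \<and>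
      fst s' ''result'' = fst s ''result'' + (\<Sum>e<e. F e)"], goal_cases)
    case (7 e s1)
    note [simp] = sameD[OF 7(4)]
    show ?case
    proof (rule WP_Ite)
      assume "bval (Less (Lit 0) (Var ''e'')) s1"
      then have e: "0 < e" using 7(3) by simp
      define u where "u = ((fst s1)(''K'' := 2 * e), snd s1)"
      have De: "snd u ''D'' d = card (below W d e)" if "e \<le> d" "2 * d \<le> n" for d
        using 7(2) that e unfolding J_def u_def by (simp add: max_def)
      have wp: "WP N sieve (\<lambda>s'. \<forall>x<n. snd s' ''D'' x =
        (if \<exists>q\<ge>1. x = (2 * q + 1) * e then snd u ''D'' x - snd u ''D'' e else snd u ''D'' x)) u"
        by (rule WP_sieve) (use n e 7(3) in \<open>auto simp: u_def\<close>)
      have K: "aval (Plus (Var ''e'') (Var ''e'')) s1 = 2 * e" using 7(3) by simp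
      show "WP N (Assign ''K'' (Plus (Var ''e'') (Var ''e'')) ;; sieve ;; multiples ;;
          Ite (Equal (Var ''R'') (Var ''m'')) quotient Skip)
        (\<lambda>s''. J (Suc e) ((fst s'')(''e'' := Suc e), snd s'') \<and>
          fst ((fst s'')(''e'' := Suc e), snd s'') ''result'' =
            fst s ''result'' + (\<Sum>e<Suc e. F e)) s1"
      proof (rule WP_Seq, rule WP_Assign, unfold K u_def[symmetric], rule WP_Seq,
          rule WP_strengthen[OF wp], goal_cases)
        case (1 s2)
        have s2: "fst s2 ''n'' = n" "fst s2 ''m'' = m" "fst s2 ''e'' = e" "fst s2 ''K'' = 2 * e"
          "fst s2 ''result'' = fst s ''result'' + (\<Sum>e<e. F e)"
          using n m 7(2,3) by (simp_all add: sameD[OF 1(2)] u_def)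
        have J2: "J (Suc e) s2" unfolding J_def
        proof (intro allI impI)
          fix d assume d: "0 < d" "Suc e \<le> d" "2 * d \<le> n"
          \<comment> \<open>Here \<open>d > e\<close> excludes \<open>q = 0\<close>, so the sieve,
            which spares \<open>e\<close> itself, agrees with \<open>card_below_Suc\<close>.\<close>
          have "(\<exists>q\<ge>1. d = (2 * q + 1) * e) \<longleftrightarrow> (\<exists>q. d = (2 * q + 1) * e)"
          proof
            assume "\<exists>q. d = (2 * q + 1) * e"
            then obtain q where q: "d = (2 * q + 1) * e" by blast
            then have "1 \<le> q" using d(2) by (cases q) auto
            then show "\<exists>q\<ge>1. d = (2 * q + 1) * e" using q by blast
          qed blast
          then have "snd s2 ''D'' d = card (below W d (Suc e))"
            using 1(1) d De[of d] De[of e] by (simp add: card_below_Suc)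
          then show "snd s2 ''D'' d = card (below W d (max 1 (Suc e)))" by simp
        qed
        have D2: "snd s2 ''D'' e = card (below W e e)" if "2 * e \<le> n"
        proof -
          have "\<not> (\<exists>q\<ge>1. e = (2 * q + 1) * e)" using e by auto
          then show ?thesis using 1(1) De[of e] that e by auto
        qed
        show ?case
        proof (rule WP_Seq, rule WP_strengthen[OF WP_multiples[where m = m and K = "2 * e"]],
            goal_cases)
          case (5 s3)
          note [simp] = sameD[OF 5(2)]
          have J3: "J (Suc e) s3" using J2 by (simp add: J_def)
          show ?case
          proof (rule WP_Ite)
            assume "bval (Equal (Var ''R'') (Var ''m'')) s3"
            then have dvd: "2 * e dvd m" using 5(1) s2 by simp
            then have le: "2 * e \<le> n" using dvd_imp_le[of "2 * e" m] m by simp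
            have "card (below W e e) \<le> 2 ^ n"
            proof -
              have "(2::nat) ^ e \<le> 2 ^ n" by (rule power_increasing) (use le in auto)
              then show ?thesis using card_below_le order_trans by blast
            qed
            then have lt: "card (below W e e) < 2 * e * 2 ^ n"
            proof -
              have "1 * 2 ^ n < 2 * e * (2 ^ n :: nat)" using e by (intro mult_strict_right_mono) auto
              then show ?thesis using \<open>card (below W e e) \<le> 2 ^ n\<close> by linarith
            qed
            show "WP N quotient (\<lambda>s''. J (Suc e) ((fst s'')(''e'' := Suc e), snd s'') \<and>
              fst ((fst s'')(''e'' := Suc e), snd s'') ''result'' =
                fst s ''result'' + (\<Sum>e<Suc e. F e)) s3"
            proof (rule WP_strengthen[OF WP_quotient[where n = n and K = "2 * e"
                  and X = "card (below W e e)"]], goal_cases)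
              case (7 s4)
              note [simp] = sameD[OF 7(2)]
              have "J (Suc e) s4" using J3 by (simp add: J_def)
              then show ?case using 7(1) s2 e dvd by (simp add: J_def F_def)
            qed (use s2 n e lt D2[OF le] in auto)
          next
            assume "\<not> bval (Equal (Var ''R'') (Var ''m'')) s3"
            then have "\<not> 2 * e dvd m" using 5(1) s2 by simp
            then show "WP N Skip (\<lambda>s''. J (Suc e) ((fst s'')(''e'' := Suc e), snd s'') \<and>
              fst ((fst s'')(''e'' := Suc e), snd s'') ''result'' =
                fst s ''result'' + (\<Sum>e<Suc e. F e)) s3"
              by (intro WP_Skip) (use J3 s2 in \<open>simp add: J_def F_def\<close>)
          qed
        qed (use s2 m n e in auto)
      qed
    next
      assume "\<not> bval (Less (Lit 0) (Var ''e'')) s1"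
      then have "e = 0" using 7(3) by simp
      then show "WP N Skip (\<lambda>s''. J (Suc e) ((fst s'')(''e'' := Suc e), snd s'') \<and>
          fst ((fst s'')(''e'' := Suc e), snd s'') ''result'' =
            fst s ''result'' + (\<Sum>e<Suc e. F e)) s1"
        by (intro WP_Skip) (use 7 in \<open>simp add: J_def F_def\<close>)
    qed
  next
    case (8 s')
    then show ?case by simp
  qed (use n D in \<open>auto simp: J_def\<close>)
qed

lemma regs_necklace_sum [simp]: "regs necklace_sum =
    {''e'', ''K'', ''f'', ''R'', ''X'', ''P'', ''Q'', ''i'', ''j'', ''result''}"
  and arrays_necklace_sum [simp]: "arrays necklace_sum = {''D'', ''T'', ''U''}"
  and depth_necklace_sum [simp]: "depth necklace_sum = 2"
  by (auto simp: necklace_sum_def)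

section \<open>Discounting the necklace of \<open>w\<close> itself\<close>

definition tie :: com where
  "tie =
     Assign ''z'' (Lit 0) ;;
     For ''j'' ''n'' (
       Assign ''y'' (Lit 1) ;;
       Assign ''p'' (Var ''j'') ;;
       For ''i'' ''n'' (
         Ite (Equal (Read ''w'' (Var ''p'')) (Read ''w'' (Var ''i''))) (Assign ''y'' (Lit 0)) Skip ;;
         incr ''p'' (Lit 1) ;;
         Ite (Equal (Var ''p'') (Var ''n'')) (Assign ''p'' (Lit 0)) Skip) ;;
       Ite (Equal (Var ''y'') (Lit 1)) (Assign ''z'' (Lit 1)) Skip) ;;
     Assign ''result'' (Minus (Var ''result'') (Var ''z''))"

text \<open>An antiperiod may be reduced modulo the period \<open>n\<close> and checked on one
  period, which leaves a search with two nested loops.\<close>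

lemma anti_iff_bounded:
  assumes "0 < n" "\<And>i. W (i + n) = W i"
  shows "(\<exists>d. anti d W) \<longleftrightarrow> (\<exists>j<n. \<forall>i<n. W ((j + i) mod n) \<noteq> W i)"
proof -
  have eq: "W (i mod n) = W i" for i by (rule periodic_mod[of W n, OF assms(2)])
  have "anti j W \<longleftrightarrow> (\<forall>i<n. W ((j + i) mod n) \<noteq> W i)" for j
  proof
    assume a: "\<forall>i<n. W ((j + i) mod n) \<noteq> W i"
    show "anti j W" unfolding anti_def
    proof
      fix i
      have "W ((j + i mod n) mod n) \<noteq> W (i mod n)" using a assms(1) by simp
      then show "W (i + j) = (\<not> W i)" unfolding eq mod_add_right_eq by (simp add: eq add.commute)
    qed
  qed (auto simp: anti_def eq add.commute)
  moreover have "(\<exists>d. anti d W) \<longleftrightarrow> (\<exists>j<n. anti j W)"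
    using anti_mod_period[of W n, OF assms(2)] assms(1) mod_less_divisor by metis
  ultimately show ?thesis by simp
qed

lemma WP_tie:
  assumes n: "fst s ''n'' = n" "n < N" "0 < n" and w: "\<And>j. j < n \<Longrightarrow> snd s ''w'' j = of_bool (W j)"
    and per: "\<And>i. W (i + n) = W i"
  shows "WP N tie (\<lambda>s'. fst s' ''result'' = fst s ''result'' - of_bool (\<exists>d. anti d W)) s"
  unfolding tie_def
proof (intro WP_Seq WP_Assign, rule WP_For[where k = n and I = "\<lambda>j s'. fst s' ''z'' =
    of_bool (\<exists>k<j. \<forall>i<n. W ((k + i) mod n) \<noteq> W i)"], goal_cases)
  case (7 j s1)
  note [simp] = sameD[OF 7(4)]
  note J = 7(1-3)
  show ?case
  proof (intro WP_Seq WP_Assign, rule WP_For[where k = n and I = "\<lambda>i s'. fst s' ''p'' = (j + i) mod n \<and>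
      fst s' ''y'' = of_bool (\<forall>l<i. W ((j + l) mod n) \<noteq> W l)"], goal_cases)
    case (7 i s2)
    note [simp] = sameD[OF 7(4)]
    have p: "(j + i) mod n < n" using n by simp
    \<comment> \<open>The wrap-around of \<open>p\<close> at \<open>n\<close> replaces the remainder
      operation.\<close>
    have nxt: "Suc (j + i) mod n = (if Suc ((j + i) mod n) = n then 0 else Suc ((j + i) mod n))"
      by (rule mod_Suc)
    have wp: "snd s2 ''w'' (fst s2 ''p'') = of_bool (W ((j + i) mod n))"
      "snd s2 ''w'' (fst s2 ''i'') = of_bool (W i)"
      using w p 7(1-3) by simp_all
    show ?case
      by (intro WP_intros) (use 7(1-3) n wp in \<open>auto simp: nxt less_Suc_eq of_bool_eq_iff\<close>)
  next
    case (8 s2)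
    note [simp] = sameD[OF 8(3)]
    define P where "P k \<longleftrightarrow> (\<forall>i<n. W ((k + i) mod n) \<noteq> W i)" for k
    have y: "fst s2 ''y'' = of_bool (P j)" using 8(1) by (simp add: P_def)
    have z: "fst s2 ''z'' = of_bool (\<exists>k<j. P k)" using J(2) by (simp add: P_def)
    have P_Suc: "(\<exists>k<Suc j. P k) \<longleftrightarrow> (\<exists>k<j. P k) \<or> P j" by (auto simp: less_Suc_eq)
    show ?case unfolding P_def[symmetric] P_Suc
      by (intro WP_intros; cases "P j") (use y z in simp_all)
  qed (use J n in auto)
next
  case (8 s')
  note [simp] = sameD[OF 8(3)]
  show ?case
    by (intro WP_Assign) (use 8 anti_iff_bounded[of n W, OF n(3) per] in simp)
qed (use n in auto)

definition rank_program :: com where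
  "rank_program = tables ;; states ;; differences ;; necklace_sum ;;
     Ite (Equal (Var ''m'') (Var ''n'')) tie Skip"

lemma regs_tables [simp]: "regs tables = {''M'', ''p'', ''a''}"
  and arrays_tables [simp]: "arrays tables = {''mul'', ''one'', ''zero''}"
  and depth_tables [simp]: "depth tables = 1"
  by (auto simp: tables_def)

lemma regs_differences [simp]: "regs differences = {''P'', ''i''}"
  and arrays_differences [simp]: "arrays differences = {''D''}"
  and depth_differences [simp]: "depth differences = 1"
  by (auto simp: differences_def)

lemma depth_rank_program: "depth rank_program = 5"
  by (simp add: rank_program_def tie_def)

text \<open>The iteration bound is \<open>Suc (length w)\<close> because the grid loops run over all
  \<open>n + 1\<close> states, the sink included.\<close>

lemma WP_rank_program:
  assumes w: "w \<noteq> []" "\<And>k. w \<le> rotate k w" and m: "0 < m" "m \<le> length w"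
  shows "WP (Suc (length w)) rank_program (\<lambda>s. final_result s = RankSN w m) (initial w m)"
proof -
  define n where "n = length w"
  define W where "W = cyc w"
  define s where "s = initial w m"
  interpret necklace_seq W n unfolding W_def by (rule necklace_seq_if_le_rotate[OF w])
  have n: "0 < n" "n < Suc n" using w(1) by (auto simp: n_def)
  have s: "fst s ''n'' = n" "fst s ''m'' = m" "fst s ''result'' = 0" "\<And>d. snd s ''A'' d = 0"
    "\<And>j. j < n \<Longrightarrow> snd s ''w'' j = of_bool (W j)"
    by (simp_all add: s_def initial_def n_def W_def cyc_nth)
  have per: "W (i + n) = W i" for i unfolding W_def n_def by (rule cyc_period)
  define R where "R = (\<Sum>e\<in>{1..m}. if 2 * e dvd m then card (below W e e) div (2 * e) else 0)"
  have rank: "RankSN w m + of_bool (m = n \<and> (\<exists>d. anti d W)) = R"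
    unfolding R_def W_def n_def by (rule RankSN_eq_sum[OF w m])
  have "WP (Suc n) rank_program (\<lambda>s. final_result s = RankSN w m) s"
    unfolding rank_program_def
  proof (rule WP_Seq, rule WP_strengthen[OF WP_tables[where n = n and W = W]], goal_cases)
    case (4 s1)
    note f1 = sameD[OF 4(2)]
    have ok: "states_ok W n s1" using 4(1) s(1) by (simp add: states_ok_def f1)
    show ?case
    proof (rule WP_Seq, rule WP_strengthen[OF WP_states[OF ok n(2)]], goal_cases)
      case (1 s2)
      note f2 = sameD[OF 1(2)]
      have A: "snd s2 ''A'' d = (\<Sum>q<n. \<Sum>r<n. pair_count W n q r d q r)" if "d < n" for d
        using 1(1) that s(4) by (simp add: f1)
      show ?case
      proof (rule WP_Seq, rule WP_strengthen[OF WP_differences[where n = n]], goal_cases)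
        case (3 s3)
        note f3 = sameD[OF 3(2)]
        have D: "snd s3 ''D'' d = card (below W d 1)" if "0 < d" "2 * d \<le> n" for d
          using 3(1) A[of d] card_below_1[OF that] that by simp
        show ?case
        proof (rule WP_Seq, rule WP_strengthen[OF WP_necklace_sum[where n = n and m = m and W = W]],
            goal_cases)
          case (8 s4)
          note f4 = sameD[OF 8(2)]
          have s4: "fst s4 ''n'' = n" "fst s4 ''m'' = m" "fst s4 ''result'' = R"
            "\<And>j. j < n \<Longrightarrow> snd s4 ''w'' j = of_bool (W j)"
            using s 8(1) by (simp_all add: f4 f3 f2 f1 R_def)
          show ?case
          proof (rule WP_Ite)
            assume "bval (Equal (Var ''m'') (Var ''n'')) s4"
            then have "m = n" using s4 by simp
            show "WP (Suc n) tie (\<lambda>s. final_result s = RankSN w m) s4"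
              by (rule WP_strengthen[OF WP_tie[where n = n and W = W]])
                (use s4 n per rank \<open>m = n\<close> in \<open>auto simp: final_result_def\<close>)
          next
            assume "\<not> bval (Equal (Var ''m'') (Var ''n'')) s4"
            then show "WP (Suc n) Skip (\<lambda>s. final_result s = RankSN w m) s4"
              using s4 rank by (intro WP_Skip) (simp add: final_result_def)
          qed
        qed (use s n m D in \<open>auto simp: f3 f2 f1 n_def\<close>)
      qed (use s n in \<open>auto simp: f2 f1\<close>)
    qed
  qed (use s n in auto)
  then show ?thesis unfolding n_def s_def .
qed

theorem mainTheorem3:
  shows "\<exists>(prog :: com) (T :: nat \<Rightarrow> nat).
    (\<lambda>n. real (T n)) \<in> O(\<lambda>n. real n ^ 6 * (log 2 (real n)) ^ 2) \<and>
    (\<forall>(n::nat) (w::word) (m::nat).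
       1 \<le> n \<longrightarrow> w \<in> words n \<longrightarrow> (\<exists>U \<in> unlabelled_necklaces n. w = canonical U) \<longrightarrow>
       1 \<le> m \<longrightarrow> m \<le> n \<longrightarrow>
       (\<exists>t s. exec prog (initial w m) t s \<and> final_result s = RankSN w m \<and> t \<le> T n))"
proof -
  obtain K where K: "\<And>N. worst_cost N rank_program \<le> K * Suc N ^ 5"
    using worst_cost_poly[of rank_program] unfolding depth_rank_program by blast
  define T where "T n = worst_cost (Suc n) rank_program" for n
  have "(\<lambda>n. real (T n)) \<in> O(\<lambda>n. real n ^ 6 * (log 2 (real n)) ^ 2)"
  \<comment> \<open>From \<open>n = 2\<close> on, \<open>Suc (Suc n) \<le> 3 * n\<close> and the
    logarithm is at least \<open>1\<close>; at \<open>n = 1\<close> the bounding function is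
    \<open>0\<close>.\<close>
  proof (rule bigoI[where c = "real (K * 3 ^ 5)"], rule eventually_sequentiallyI[of 2])
    fix n :: nat assume n: "2 \<le> n"
    have "T n \<le> K * Suc (Suc n) ^ 5" unfolding T_def by (rule K)
    also have "\<dots> \<le> K * (3 * n) ^ 5" using n by (intro mult_le_mono2 power_mono) auto
    also have "\<dots> = K * 3 ^ 5 * n ^ 5" by (simp add: power_mult_distrib)
    finally have "real (T n) \<le> real (K * 3 ^ 5) * real n ^ 5"
      by (metis of_nat_le_iff of_nat_mult of_nat_power)
    moreover have "real n ^ 5 * 1 \<le> real n ^ 6 * (log 2 (real n)) ^ 2"
    proof (rule mult_mono)
      show "real n ^ 5 \<le> real n ^ 6" using n by (intro power_increasing) auto
      have "1 \<le> log 2 (real n)" using n by simp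
      then show "1 \<le> (log 2 (real n)) ^ 2" by (rule one_le_power)
    qed auto
    ultimately have "real (T n) \<le> real (K * 3 ^ 5) * (real n ^ 6 * (log 2 (real n)) ^ 2)"
      by (metis mult.right_neutral mult_left_mono of_nat_0_le_iff order_trans)
    then show "norm (real (T n)) \<le> real (K * 3 ^ 5) * norm (real n ^ 6 * (log 2 (real n)) ^ 2)"
      by (simp add: abs_mult)
  qed
  moreover have "\<exists>t s. exec rank_program (initial w m) t s \<and> final_result s = RankSN w m \<and> t \<le> T n"
    if "1 \<le> n" "w \<in> words n" "U \<in> unlabelled_necklaces n" "w = canonical U" "1 \<le> m" "m \<le> n"
    for n w m U
  proof -
    have len: "length w = n" using that(2) by (simp add: words_def)
    then have "w \<noteq> []" using that(1) by auto
    then have "WP (Suc (length w)) rank_program (\<lambda>s. final_result s = RankSN w m) (initial w m)"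
      using le_rotate_if_canonical[OF that(2-4)] that(5,6) len by (intro WP_rank_program) auto
    then show ?thesis unfolding WP_def T_def len by blast
  qed
  ultimately show ?thesis by blast
qed

end
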